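(* Let $(M^3,g)$ be a 3-dimensional connected oriented pseudo-Riemannian manifold and let $\alpha\colon I\to M^3$ ($I$ an open interval) be a non-null, non-degenerate, arc length parametrized curve with $g(\nabla_{\alpha'}\alpha',\nabla_{\alpha'}\alpha')\neq0$ at every point. Let $(\mathbf T,\mathbf N,\mathbf B)$ be its Frenet frame, with signs $\varepsilon_1,\varepsilon_2,\varepsilon_3$, curvature $\kappa>0$ and torsion $\tau$. Then the Cartan frame $(\mathbf e_1,\mathbf e_2,\mathbf e_3)$ of $\alpha$ is given by $$\mathbf e_1=\kappa^{-1/3}|\tau|^{-1/6}\,\mathbf T,$$ $$\mathbf e_2=-\tfrac16\kappa^{-5/3}\tau^{-1}|\tau|^{-1/3}\left(2\tau\kappa'+\kappa\tau'\right)\mathbf T+\varepsilon_2\kappa^{1/3}|\tau|^{-1/3}\,\mathbf N,$$ $$\mathbf e_3=\tfrac1{18}\kappa^{-3}\tau^{-2}|\tau|^{-1/2}\left(-18\varepsilon_1\varepsilon_2\kappa^4\tau^2+10\tau^2\kappa'^2+4\kappa\tau\kappa'\tau'+4\kappa^2\tau'^2-6\kappa\tau^2\kappa''-3\kappa^2\tau\tau''\right)\mathbf T-\tfrac12\varepsilon_2\tau^{-1}|\tau|^{-1/2}\tau'\,\mathbf N+\varepsilon_2\varepsilon_3\tau|\tau|^{-1/2}\,\mathbf B.$$ Moreover, the equi-affine curvatures $\varkappa_1,\varkappa_2$ of $\alpha$ are given by $$\begin{aligned}\varkappa_1=\tfrac1{216}\kappa^{-4}\tau^{-3}|\tau|^{-1/2}\big(&-288\varepsilon_1\varepsilon_2\kappa^4\tau^3\kappa'-72\varepsilon_2\varepsilon_3\kappa^2\tau^5\kappa'-320\tau^3\kappa'^3+180\varepsilon_1\varepsilon_2\kappa^5\tau^2\tau'-36\varepsilon_2\varepsilon_3\kappa^3\tau^4\tau'\\&-120\kappa\tau^2\kappa'^2\tau'-42\kappa^2\tau\kappa'\tau'^2-85\kappa^3\tau'^3+360\kappa\tau^3\kappa'\kappa''+72\kappa^2\tau^2\tau'\kappa''\\&+36\kappa^2\tau^2\kappa'\tau''+126\kappa^3\tau\tau'\tau''-72\kappa^2\tau^3\kappa'''-36\kappa^3\tau^2\tau'''\big),\end{aligned}$$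 $$\begin{aligned}\varkappa_2=\tfrac1{36}\kappa^{-8/3}\tau^{-2}|\tau|^{-1/3}\big(&-36\varepsilon_1\varepsilon_2\kappa^4\tau^2-36\varepsilon_2\varepsilon_3\kappa^2\tau^4+20\tau^2\kappa'^2+8\kappa\tau\kappa'\tau'+35\kappa^2\tau'^2\\&-12\kappa\tau^2\kappa''-24\kappa^2\tau\tau''\big).\end{aligned}$$
   Context: Let $(M^3,g)$ be a connected oriented 3-dimensional pseudo-Riemannian manifold (any signature, including Riemannian), $\nabla$ its Levi-Civita connection, and $\Omega$ its natural volume form compatible with the orientation, i.e. in positively oriented local coordinates $\Omega(\partial_i,\partial_j,\partial_k)=\sqrt{|G|}\,\varepsilon_{ijk}$, with $G=\det[g_{ij}]$ and $\varepsilon_{ijk}$ the Levi-Civita symbol (so $\Omega=1$ on positively oriented orthonormal frames). Put $\omega=\operatorname{sign}G$. The cross product is defined by $g(X\times Y,Z)=\Omega(X,Y,Z)$ for all $Z$. Frenet frame: let $\alpha\colon I\to M^3$ be a smooth non-null curve parametrized by arc length, $g(\alpha',\alpha')=\varepsilon_1\in\{1,-1\}$, with $g(\nabla_{\alpha'}\alpha',\nabla_{\alpha'}\alpha')\neq0$ everywhere. Put $\mathbf T=\alpha'$ and $\varepsilon_2=\operatorname{sign}g(\nabla_{\mathbf T}\mathbf T,\nabla_{\mathbf T}\mathbf T)$. The unit principal normal $\mathbf N$ and the positive function $\kappa$ (curvature) are defined by $\nabla_{\mathbf T}\mathbf T=\varepsilon_2\kappa\mathbf N$, $g(\mathbf N,\mathbf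 N)=\varepsilon_2$. Put $\varepsilon_3=\omega\varepsilon_1\varepsilon_2$ and $\mathbf B=\varepsilon_3\,\mathbf T\times\mathbf N$; then $g(\mathbf B,\mathbf B)=\varepsilon_3$ and $\Omega(\mathbf T,\mathbf N,\mathbf B)=1$. The torsion $\tau$ is the function with $\nabla_{\mathbf T}\mathbf N=-\varepsilon_1\kappa\mathbf T+\varepsilon_3\tau\mathbf B$; also $\nabla_{\mathbf T}\mathbf B=-\varepsilon_2\tau\mathbf N$. Equi-affine objects: $(M^3,\nabla,\Omega)$ is regarded as an equi-affine manifold. With $\nabla^2_{\alpha'}\alpha'=\nabla_{\alpha'}(\nabla_{\alpha'}\alpha')$, the curve $\alpha$ is non-degenerate if $\Omega(\alpha',\nabla_{\alpha'}\alpha',\nabla^2_{\alpha'}\alpha')\neq0$ at every point (here this quantity equals $\varepsilon_3\kappa^2\tau$, so $\tau$ is nowhere zero). Put $\varphi=|\Omega(\alpha',\nabla_{\alpha'}\alpha',\nabla^2_{\alpha'}\alpha')|^{-1/6}$. The Cartan frame is $\mathbf e_1=\varphi\alpha'$, $\mathbf e_2=\nabla_{\mathbf e_1}\mathbf e_1$, $\mathbf e_3=\nabla_{\mathbf e_1}\mathbf e_2$, where $\nabla_{\mathbf e_1}=\varphi\nabla_{\alpha'}$. The equi-affine curvatures $\varkappa_1,\varkappa_2$ are the unique functions on $I$ with $\nabla_{\mathbf e_1}\mathbf e_3=\varkappa_1\mathbf e_1+\varkappa_2\mathbf e_2$. Primes on functions denote derivatives with respect to the arc length parameter. *)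

theory Defs
  imports "HOL-Analysis.Analysis"
begin

section \<open>Smooth maps between Euclidean spaces\<close>

text \<open>
  On open sets this is the usual \<open>C\<^sup>k\<close> notion: all iterated directional derivatives
  up to order \<open>k\<close> exist and are differentiable resp. continuous.
\<close>

primrec Ck_on :: "nat \<Rightarrow> ('a::euclidean_space \<Rightarrow> 'b::real_normed_vector) \<Rightarrow> 'a set \<Rightarrow> bool" where
  "Ck_on 0 f S \<longleftrightarrow> continuous_on S f"
| "Ck_on (Suc k) f S \<longleftrightarrow>
     (\<forall>x\<in>S. f differentiable (at x)) \<and> (\<forall>v. Ck_on k (\<lambda>x. frechet_derivative f (at x) v) S)"

definition smooth_on :: "('a::euclidean_space \<Rightarrow> 'b::real_normed_vector) \<Rightarrow> 'a set \<Rightarrow> bool" where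
  "smooth_on f S \<longleftrightarrow> (\<forall>k. Ck_on k f S)"

definition partial :: "3 \<Rightarrow> (real^3 \<Rightarrow> 'b::real_normed_vector) \<Rightarrow> real^3 \<Rightarrow> 'b" where
  "partial i f x = frechet_derivative f (at x) (axis i 1)"


section \<open>Charts and tangent vectors\<close>

text \<open>A chart is a pair of its domain and its coordinate map.\<close>

type_synonym 'a chart = "'a set \<times> ('a \<Rightarrow> real^3)"

text \<open>
  A tangent vector at \<open>p\<close> is given by its coordinate components in all charts around \<open>p\<close>,
  which have to transform by the derivatives of the coordinate changes
  (see \<open>tangent_space\<close> below).  The components in charts not containing \<open>p\<close> are set
  to \<open>0\<close>, so that equality of tangent vectors is equality of functions.
\<close>

type_synonym 'a tvec = "'a chart \<Rightarrow> real^3"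

definition tzero :: "'a tvec" where
  "tzero = (\<lambda>c. 0)"

definition tadd :: "'a tvec \<Rightarrow> 'a tvec \<Rightarrow> 'a tvec"  (infixl "+\<^sub>t" 65) where
  "u +\<^sub>t v = (\<lambda>c. u c + v c)"

definition tscale :: "real \<Rightarrow> 'a tvec \<Rightarrow> 'a tvec"  (infixr "*\<^sub>t" 75) where
  "a *\<^sub>t v = (\<lambda>c. a *\<^sub>R v c)"

definition coord_inv :: "'a chart \<Rightarrow> real^3 \<Rightarrow> 'a" where
  "coord_inv c = inv_into (fst c) (snd c)"

definition transition :: "'a chart \<Rightarrow> 'a chart \<Rightarrow> real^3 \<Rightarrow> real^3" where
  "transition c d = snd d \<circ> coord_inv c"

definition dtransition :: "'a chart \<Rightarrow> 'a chart \<Rightarrow> 'a \<Rightarrow> real^3 \<Rightarrow> real^3" where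
  "dtransition c d p = frechet_derivative (transition c d) (at (snd c p))"


section \<open>Oriented pseudo-Riemannian 3-manifolds\<close>

text \<open>
  The atlas determines the smooth structure as well as the orientation: its charts are, by
  definition, the positively oriented ones.  The value \<open>metric M p u v\<close> is only
  meaningful for tangent vectors \<open>u\<close>, \<open>v\<close> at \<open>p\<close>.
\<close>

record 'a psr3 =
  points :: "'a topology"
  atlas :: "'a chart set"
  metric :: "'a \<Rightarrow> 'a tvec \<Rightarrow> 'a tvec \<Rightarrow> real"

definition charts_at :: "('a, 'b) psr3_scheme \<Rightarrow> 'a \<Rightarrow> 'a chart set" where
  "charts_at M p = {c \<in> atlas M. p \<in> fst c}"

definition tangent_space :: "('a, 'b) psr3_scheme \<Rightarrow> 'a \<Rightarrow> 'a tvec set" where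
  "tangent_space M p =
     {v. (\<forall>c\<in>charts_at M p. \<forall>d\<in>charts_at M p. v d = dtransition c d p (v c)) \<and>
         (\<forall>c. c \<notin> charts_at M p \<longrightarrow> v c = 0)}"

text \<open>The tangent vector at \<open>p\<close> with components \<open>x\<close> in the chart \<open>c\<close>:\<close>

definition from_coords :: "('a, 'b) psr3_scheme \<Rightarrow> 'a chart \<Rightarrow> 'a \<Rightarrow> real^3 \<Rightarrow> 'a tvec" where
  "from_coords M c p x = (\<lambda>d. if d \<in> charts_at M p then dtransition c d p x else 0)"

definition coord_vec :: "('a, 'b) psr3_scheme \<Rightarrow> 'a chart \<Rightarrow> 3 \<Rightarrow> 'a \<Rightarrow> 'a tvec" where
  "coord_vec M c i p = from_coords M c p (axis i 1)"

definition gram :: "('a, 'b) psr3_scheme \<Rightarrow> 'a chart \<Rightarrow> 'a \<Rightarrow> real^3^3" where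
  "gram M c p = (\<chi> i j. metric M p (coord_vec M c i p) (coord_vec M c j p))"

definition oriented_manifold :: "('a, 'b) psr3_scheme \<Rightarrow> bool" where
  "oriented_manifold M \<longleftrightarrow>
     Hausdorff_space (points M) \<and> second_countable (points M) \<and>
     \<Union> (fst ` atlas M) = topspace (points M) \<and>
     (\<forall>c\<in>atlas M.
        openin (points M) (fst c) \<and> open (snd c ` fst c) \<and>
        homeomorphic_map (subtopology (points M) (fst c)) (top_of_set (snd c ` fst c)) (snd c)) \<and>
     (\<forall>c\<in>atlas M. \<forall>d\<in>atlas M.
        smooth_on (transition c d) (snd c ` (fst c \<inter> fst d)) \<and>
        (\<forall>p\<in>fst c \<inter> fst d. det (matrix (dtransition c d p)) > 0))"

definition pseudo_riemannian_metric :: "('a, 'b) psr3_scheme \<Rightarrow> bool" where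
  "pseudo_riemannian_metric M \<longleftrightarrow>
     (\<forall>p\<in>topspace (points M).
        (\<forall>u\<in>tangent_space M p. \<forall>v\<in>tangent_space M p. metric M p u v = metric M p v u) \<and>
        (\<forall>u\<in>tangent_space M p. \<forall>v\<in>tangent_space M p. \<forall>w\<in>tangent_space M p. \<forall>a.
           metric M p (a *\<^sub>t u +\<^sub>t v) w = a * metric M p u w + metric M p v w) \<and>
        (\<forall>u\<in>tangent_space M p. (\<forall>w\<in>tangent_space M p. metric M p u w = 0) \<longrightarrow> u = tzero)) \<and>
     (\<forall>c\<in>atlas M. \<forall>i j. smooth_on (\<lambda>x. gram M c (coord_inv c x) $ i $ j) (snd c ` fst c))"

definition connected_oriented_psr3 :: "('a, 'b) psr3_scheme \<Rightarrow> bool" where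
  "connected_oriented_psr3 M \<longleftrightarrow>
     oriented_manifold M \<and> connected_space (points M) \<and> pseudo_riemannian_metric M"

text \<open>The sign \<open>\<omega>\<close> of the Gram determinant, which is constant on a connected manifold:\<close>

definition metric_sign :: "('a, 'b) psr3_scheme \<Rightarrow> real" where
  "metric_sign M =
     (THE s. \<forall>p\<in>topspace (points M). \<forall>c\<in>charts_at M p. sgn (det (gram M c p)) = s)"

text \<open>
  In every (positively oriented) chart the volume form is \<open>\<surd>\<bar>G\<bar>\<close> times the determinant of
  the components, i.e. \<open>\<surd>\<bar>G\<bar> \<epsilon>\<^sub>i\<^sub>j\<^sub>k\<close> on coordinate vectors.
\<close>

definition volume :: "('a, 'b) psr3_scheme \<Rightarrow> 'a \<Rightarrow> 'a tvec \<Rightarrow> 'a tvec \<Rightarrow> 'a tvec \<Rightarrow> real" where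
  "volume M p u v w =
     (THE r. \<forall>c\<in>charts_at M p.
        r = sqrt \<bar>det (gram M c p)\<bar> * det (vector [u c, v c, w c] :: real^3^3))"

definition cross :: "('a, 'b) psr3_scheme \<Rightarrow> 'a \<Rightarrow> 'a tvec \<Rightarrow> 'a tvec \<Rightarrow> 'a tvec" where
  "cross M p u v =
     (THE w. w \<in> tangent_space M p \<and>
        (\<forall>z\<in>tangent_space M p. metric M p w z = volume M p u v z))"


section \<open>The Levi-Civita connection\<close>

text \<open>
  A connection is given by its Christoffel symbols: \<open>D c p i j\<close> is the vector of components,
  in the chart \<open>c\<close>, of the covariant derivative of the \<open>j\<close>-th coordinate field in the
  direction of the \<open>i\<close>-th one, so \<open>D c p i j $ k\<close> is \<open>\<Gamma>\<^sup>k\<^sub>i\<^sub>j(p)\<close>.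
  The second condition is the transformation law of Christoffel symbols.
\<close>

type_synonym 'a connection = "'a chart \<Rightarrow> 'a \<Rightarrow> 3 \<Rightarrow> 3 \<Rightarrow> real^3"

definition affine_connection :: "('a, 'b) psr3_scheme \<Rightarrow> 'a connection \<Rightarrow> bool" where
  "affine_connection M D \<longleftrightarrow>
     (\<forall>c\<in>atlas M. \<forall>i j. smooth_on (\<lambda>x. D c (coord_inv c x) i j) (snd c ` fst c)) \<and>
     (\<forall>c\<in>atlas M. \<forall>d\<in>atlas M. \<forall>p\<in>fst c \<inter> fst d. \<forall>i j.
        dtransition c d p (D c p i j) =
          (\<Sum>a\<in>UNIV. \<Sum>b\<in>UNIV.
             (dtransition c d p (axis i 1) $ a * dtransition c d p (axis j 1) $ b) *\<^sub>R D d p a b) +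
          partial i (partial j (transition c d)) (snd c p))"

text \<open>
  The Levi-Civita connection: torsion-free and compatible with the metric.  As coordinate
  fields commute and both conditions are tensorial, it suffices to state them for
  coordinate fields.
\<close>

definition levi_civita :: "('a, 'b) psr3_scheme \<Rightarrow> 'a connection \<Rightarrow> bool" where
  "levi_civita M D \<longleftrightarrow>
     affine_connection M D \<and>
     (\<forall>c\<in>atlas M. \<forall>p\<in>fst c.
        (\<forall>i j. D c p i j = D c p j i) \<and>
        (\<forall>i j k. partial k (\<lambda>x. gram M c (coord_inv c x) $ i $ j) (snd c p) =
           metric M p (from_coords M c p (D c p k i)) (coord_vec M c j p) +
           metric M p (coord_vec M c i p) (from_coords M c p (D c p k j))))"


section \<open>Curves\<close>

definition smooth_curve :: "('a, 'b) psr3_scheme \<Rightarrow> real set \<Rightarrow> (real \<Rightarrow> 'a) \<Rightarrow> bool" where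
  "smooth_curve M I \<alpha> \<longleftrightarrow>
     continuous_map (top_of_set I) (points M) \<alpha> \<and>
     (\<forall>c\<in>atlas M. smooth_on (\<lambda>t. snd c (\<alpha> t)) {t \<in> I. \<alpha> t \<in> fst c})"

definition velocity :: "('a, 'b) psr3_scheme \<Rightarrow> (real \<Rightarrow> 'a) \<Rightarrow> real \<Rightarrow> 'a tvec" where
  "velocity M \<alpha> t =
     (\<lambda>c. if c \<in> charts_at M (\<alpha> t) then vector_derivative (\<lambda>s. snd c (\<alpha> s)) (at t) else 0)"

text \<open>The covariant derivative along \<open>\<alpha>\<close> of a vector field \<open>X\<close> along \<open>\<alpha>\<close>:\<close>

definition covd ::
  "('a, 'b) psr3_scheme \<Rightarrow> 'a connection \<Rightarrow> (real \<Rightarrow> 'a) \<Rightarrow> (real \<Rightarrow> 'a tvec) \<Rightarrow> real \<Rightarrow> 'a tvec" where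
  "covd M D \<alpha> X t =
     (\<lambda>c. if c \<in> charts_at M (\<alpha> t)
          then vector_derivative (\<lambda>s. X s c) (at t) +
               (\<Sum>i\<in>UNIV. \<Sum>j\<in>UNIV. (velocity M \<alpha> t c $ i * X t c $ j) *\<^sub>R D c (\<alpha> t) i j)
          else 0)"

definition acceleration ::
  "('a, 'b) psr3_scheme \<Rightarrow> 'a connection \<Rightarrow> (real \<Rightarrow> 'a) \<Rightarrow> real \<Rightarrow> 'a tvec" where
  "acceleration M D \<alpha> = covd M D \<alpha> (velocity M \<alpha>)"


section \<open>The Frenet frame\<close>

definition arc_length_parametrized ::
  "('a, 'b) psr3_scheme \<Rightarrow> real set \<Rightarrow> (real \<Rightarrow> 'a) \<Rightarrow> bool" where
  "arc_length_parametrized M I \<alpha> \<longleftrightarrow>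
     (\<exists>\<epsilon>\<in>{1, -1}. \<forall>t\<in>I. metric M (\<alpha> t) (velocity M \<alpha> t) (velocity M \<alpha> t) = \<epsilon>)"

text \<open>
  The signs do not depend on the parameter when \<open>I\<close> is an interval, hence the
  definite descriptions.
\<close>

definition frenet_eps1 :: "('a, 'b) psr3_scheme \<Rightarrow> real set \<Rightarrow> (real \<Rightarrow> 'a) \<Rightarrow> real" where
  "frenet_eps1 M I \<alpha> =
     (THE \<epsilon>. \<forall>t\<in>I. metric M (\<alpha> t) (velocity M \<alpha> t) (velocity M \<alpha> t) = \<epsilon>)"

definition frenet_eps2 ::
  "('a, 'b) psr3_scheme \<Rightarrow> 'a connection \<Rightarrow> real set \<Rightarrow> (real \<Rightarrow> 'a) \<Rightarrow> real" where
  "frenet_eps2 M D I \<alpha> =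
     (THE \<epsilon>. \<forall>t\<in>I. sgn (metric M (\<alpha> t) (acceleration M D \<alpha> t) (acceleration M D \<alpha> t)) = \<epsilon>)"

definition frenet_eps3 ::
  "('a, 'b) psr3_scheme \<Rightarrow> 'a connection \<Rightarrow> real set \<Rightarrow> (real \<Rightarrow> 'a) \<Rightarrow> real" where
  "frenet_eps3 M D I \<alpha> = metric_sign M * frenet_eps1 M I \<alpha> * frenet_eps2 M D I \<alpha>"

text \<open>Curvature and principal normal are determined together, by the same two equations.\<close>

definition curvature ::
  "('a, 'b) psr3_scheme \<Rightarrow> 'a connection \<Rightarrow> real set \<Rightarrow> (real \<Rightarrow> 'a) \<Rightarrow> real \<Rightarrow> real" where
  "curvature M D I \<alpha> t =
     (THE k. k > 0 \<and>
        (\<exists>n\<in>tangent_space M (\<alpha> t).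
           metric M (\<alpha> t) n n = frenet_eps2 M D I \<alpha> \<and>
           acceleration M D \<alpha> t = (frenet_eps2 M D I \<alpha> * k) *\<^sub>t n))"

definition principal_normal ::
  "('a, 'b) psr3_scheme \<Rightarrow> 'a connection \<Rightarrow> real set \<Rightarrow> (real \<Rightarrow> 'a) \<Rightarrow> real \<Rightarrow> 'a tvec" where
  "principal_normal M D I \<alpha> t =
     (THE n. n \<in> tangent_space M (\<alpha> t) \<and>
        metric M (\<alpha> t) n n = frenet_eps2 M D I \<alpha> \<and>
        acceleration M D \<alpha> t = (frenet_eps2 M D I \<alpha> * curvature M D I \<alpha> t) *\<^sub>t n)"

definition binormal ::
  "('a, 'b) psr3_scheme \<Rightarrow> 'a connection \<Rightarrow> real set \<Rightarrow> (real \<Rightarrow> 'a) \<Rightarrow> real \<Rightarrow> 'a tvec" where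
  "binormal M D I \<alpha> t =
     frenet_eps3 M D I \<alpha> *\<^sub>t cross M (\<alpha> t) (velocity M \<alpha> t) (principal_normal M D I \<alpha> t)"

definition torsion ::
  "('a, 'b) psr3_scheme \<Rightarrow> 'a connection \<Rightarrow> real set \<Rightarrow> (real \<Rightarrow> 'a) \<Rightarrow> real \<Rightarrow> real" where
  "torsion M D I \<alpha> t =
     (THE r. covd M D \<alpha> (principal_normal M D I \<alpha>) t =
        (- frenet_eps1 M I \<alpha> * curvature M D I \<alpha> t) *\<^sub>t velocity M \<alpha> t +\<^sub>t
        (frenet_eps3 M D I \<alpha> * r) *\<^sub>t binormal M D I \<alpha> t)"


section \<open>The Cartan frame and the equi-affine curvatures\<close>

definition equiaffine_volume ::
  "('a, 'b) psr3_scheme \<Rightarrow> 'a connection \<Rightarrow> (real \<Rightarrow> 'a) \<Rightarrow> real \<Rightarrow> real" where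
  "equiaffine_volume M D \<alpha> t =
     volume M (\<alpha> t) (velocity M \<alpha> t) (acceleration M D \<alpha> t) (covd M D \<alpha> (acceleration M D \<alpha>) t)"

definition nondegenerate_curve ::
  "('a, 'b) psr3_scheme \<Rightarrow> 'a connection \<Rightarrow> real set \<Rightarrow> (real \<Rightarrow> 'a) \<Rightarrow> bool" where
  "nondegenerate_curve M D I \<alpha> \<longleftrightarrow> (\<forall>t\<in>I. equiaffine_volume M D \<alpha> t \<noteq> 0)"

definition equiaffine_speed ::
  "('a, 'b) psr3_scheme \<Rightarrow> 'a connection \<Rightarrow> (real \<Rightarrow> 'a) \<Rightarrow> real \<Rightarrow> real" where
  "equiaffine_speed M D \<alpha> t = \<bar>equiaffine_volume M D \<alpha> t\<bar> powr (-1/6)"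

definition cartan_e1 ::
  "('a, 'b) psr3_scheme \<Rightarrow> 'a connection \<Rightarrow> (real \<Rightarrow> 'a) \<Rightarrow> real \<Rightarrow> 'a tvec" where
  "cartan_e1 M D \<alpha> t = equiaffine_speed M D \<alpha> t *\<^sub>t velocity M \<alpha> t"

text \<open>Covariant derivative in the direction of the first Cartan vector:\<close>

definition covd_e1 ::
  "('a, 'b) psr3_scheme \<Rightarrow> 'a connection \<Rightarrow> (real \<Rightarrow> 'a) \<Rightarrow> (real \<Rightarrow> 'a tvec) \<Rightarrow> real \<Rightarrow> 'a tvec" where
  "covd_e1 M D \<alpha> X t = equiaffine_speed M D \<alpha> t *\<^sub>t covd M D \<alpha> X t"

definition cartan_e2 ::
  "('a, 'b) psr3_scheme \<Rightarrow> 'a connection \<Rightarrow> (real \<Rightarrow> 'a) \<Rightarrow> real \<Rightarrow> 'a tvec" where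
  "cartan_e2 M D \<alpha> = covd_e1 M D \<alpha> (cartan_e1 M D \<alpha>)"

definition cartan_e3 ::
  "('a, 'b) psr3_scheme \<Rightarrow> 'a connection \<Rightarrow> (real \<Rightarrow> 'a) \<Rightarrow> real \<Rightarrow> 'a tvec" where
  "cartan_e3 M D \<alpha> = covd_e1 M D \<alpha> (cartan_e2 M D \<alpha>)"

definition equiaffine_curvatures ::
  "('a, 'b) psr3_scheme \<Rightarrow> 'a connection \<Rightarrow> (real \<Rightarrow> 'a) \<Rightarrow> real \<Rightarrow> real \<times> real" where
  "equiaffine_curvatures M D \<alpha> t =
     (THE k. covd_e1 M D \<alpha> (cartan_e3 M D \<alpha>) t =
        fst k *\<^sub>t cartan_e1 M D \<alpha> t +\<^sub>t snd k *\<^sub>t cartan_e2 M D \<alpha> t)"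

definition equiaffine_curvature1 ::
  "('a, 'b) psr3_scheme \<Rightarrow> 'a connection \<Rightarrow> (real \<Rightarrow> 'a) \<Rightarrow> real \<Rightarrow> real" where
  "equiaffine_curvature1 M D \<alpha> t = fst (equiaffine_curvatures M D \<alpha> t)"

definition equiaffine_curvature2 ::
  "('a, 'b) psr3_scheme \<Rightarrow> 'a connection \<Rightarrow> (real \<Rightarrow> 'a) \<Rightarrow> real \<Rightarrow> real" where
  "equiaffine_curvature2 M D \<alpha> t = snd (equiaffine_curvatures M D \<alpha> t)"

end

theory Submission
  imports Defs
begin

text \<open>
  Along the curve, the Frenet equations \<open>\<nabla>\<^sub>T T = \<epsilon>\<^sub>2 \<kappa> N\<close>, \<open>\<nabla>\<^sub>T N = - \<epsilon>\<^sub>1 \<kappa> T + \<epsilon>\<^sub>3 \<tau> B\<close>,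
  \<open>\<nabla>\<^sub>T B = - \<epsilon>\<^sub>2 \<tau> N\<close> follow from the compatibility of the connection with the metric, and they give
  \<open>\<Omega>(T, \<nabla>\<^sub>T T, \<nabla>\<^sup>2\<^sub>T T) = \<epsilon>\<^sub>3 \<kappa>\<^sup>2 \<tau>\<close>, hence \<open>\<phi> = \<kappa> powr (-1/3) * \<bar>\<tau>\<bar> powr (-1/6)\<close>.  Every vector of the
  Cartan frame is a power of \<open>\<phi>\<close> times a field whose Frenet components are rational in the
  derivatives of \<open>\<kappa>\<close> and \<open>\<tau>\<close>; since \<open>\<phi>' = \<phi> \<rho>\<close> with \<open>\<rho>\<close> rational as well, each application of
  \<open>\<nabla>\<close> only acts on these components.
\<close>

section \<open>Calculus of smooth maps\<close>

text \<open>Volume, cross product, signs, curvature, normal, torsion and the equi-affine curvatures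
  are definite descriptions: each needs existence and uniqueness before it can be used, and its
  smoothness has to come from an explicit formula. For the cross product this is a formula in
  coordinates, for \<open>\<kappa>\<close> a square root, for \<open>\<tau>\<close> the scalar
  product of \<open>B\<close> with the covariant derivative of \<open>N\<close>. The function
  \<open>\<rho>\<close> is -1/6 times the logarithmic derivative of
  \<open>\<kappa>\<^sup>2 \<tau>\<close>. The exponent -1/6 in the speed makes the volume of the
  Cartan frame 1 or -1. As the volume form is parallel, the derivative of the third Cartan vector
  then stays in the plane of the first two, which is why two curvatures suffice; here this appears
  as the algebraic cancellation of the \<open>B\<close> component. \<open>\<tau>\<close> may be
  negative, so powers of its absolute value are handled as powers of its square.\<close>

lemma Ck_on_cong:
  assumes "open S" "\<And>x. x \<in> S \<Longrightarrow> f x = g x" "Ck_on k f S"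
  shows "Ck_on k g S"
  using assms(2,3)
proof (induction k arbitrary: f g)
  case 0
  then show ?case by (simp cong: continuous_on_cong)
next
  case (Suc k)
  have "g differentiable (at x)" if "x \<in> S" for x
    using Suc.prems that assms(1)
    by (meson Ck_on.simps(2) differentiable_def has_derivative_transform_within_open)
  moreover have "Ck_on k (\<lambda>x. frechet_derivative g (at x) v) S" for v
  proof (rule Suc.IH)
    show "frechet_derivative f (at x) v = frechet_derivative g (at x) v" if "x \<in> S" for x
      using frechet_derivative_transform_within_open[of f x S g] Suc.prems that assms(1) by auto
  qed (use Suc.prems in auto)
  ultimately show ?case by simp
qed

text \<open>\<open>Ck_on\<close> only involves limits at points, so it can be checked near each
  point. This serves functions on \<open>I\<close> for which a formula is available only while the
  curve stays in one chart.\<close>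

lemma Ck_on_local:
  assumes "\<And>x. x \<in> S \<Longrightarrow> \<exists>U. open U \<and> x \<in> U \<and> Ck_on k f U"
  shows "Ck_on k f S"
  using assms
proof (induction k arbitrary: f)
  case 0
  have "isCont f x" if x: "x \<in> S" for x
  proof -
    obtain U where "open U" "x \<in> U" "continuous_on U f"
      using 0[OF x] by auto
    then show ?thesis by (simp add: continuous_on_eq_continuous_at)
  qed
  then show ?case by (simp add: continuous_at_imp_continuous_on)
next
  case (Suc k)
  have "f differentiable (at x)" if "x \<in> S" for x
    using Suc.prems[OF that] by auto
  moreover have "Ck_on k (\<lambda>x. frechet_derivative f (at x) v) S" for v
    by (rule Suc.IH) (metis Ck_on.simps(2) Suc.prems)
  ultimately show ?case by simp
qed

lemma Ck_on_subset: "Ck_on k f S \<Longrightarrow> T \<subseteq> S \<Longrightarrow> Ck_on k f T"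
  by (induction k arbitrary: f) (auto intro: continuous_on_subset)

lemma Ck_on_SucD: "Ck_on (Suc k) f S \<Longrightarrow> Ck_on k f S"
proof (induction k arbitrary: f)
  case 0
  then show ?case
    by (simp add: continuous_at_imp_continuous_on differentiable_imp_continuous_within)
qed auto

lemma Ck_on_const: "Ck_on k (\<lambda>x. c) S"
  by (induction k arbitrary: c) auto

text \<open>By uniqueness of derivatives any pointwise derivative \<open>f'\<close> can take the
  place of \<open>frechet_derivative\<close>; openness of \<open>S\<close> transfers its
  regularity.\<close>

lemma Ck_on_SucI:
  assumes "open S" "\<And>x. x \<in> S \<Longrightarrow> (f has_derivative f' x) (at x)"
    "\<And>v. Ck_on k (\<lambda>x. f' x v) S"
  shows "Ck_on (Suc k) f S"
proof -
  have "Ck_on k (\<lambda>x. frechet_derivative f (at x) v) S" for v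
    by (rule Ck_on_cong[OF assms(1) _ assms(3)[of v]])
       (use assms(2) frechet_derivative_at in metis)
  then show ?thesis using assms(2) by (auto simp: differentiable_def)
qed

lemma Ck_on_add:
  assumes "open S"
  shows "Ck_on k f S \<Longrightarrow> Ck_on k g S \<Longrightarrow> Ck_on k (\<lambda>x. f x + g x) S"
proof (induction k arbitrary: f g)
  case 0
  then show ?case by (simp add: continuous_on_add)
next
  case (Suc k)
  show ?case
    by (rule Ck_on_SucI[OF assms,
          of _ "\<lambda>x v. frechet_derivative f (at x) v + frechet_derivative g (at x) v"])
       (use Suc in \<open>auto intro: has_derivative_add simp flip: frechet_derivative_works\<close>)
qed

lemma (in bounded_bilinear) Ck_on_bilinear:
  fixes f :: "'d::euclidean_space \<Rightarrow> 'a"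
  assumes "open S"
  shows "Ck_on k f S \<Longrightarrow> Ck_on k g S \<Longrightarrow> Ck_on k (\<lambda>x. prod (f x) (g x)) S"
proof (induction k arbitrary: f g)
  case 0
  then show ?case by (simp add: continuous_on)
next
  case (Suc k)
  have *: "Ck_on k f S" "Ck_on k g S" using Suc.prems by (blast intro: Ck_on_SucD)+
  show ?case
    by (rule Ck_on_SucI[OF assms,
          of _ "\<lambda>x v. prod (f x) (frechet_derivative g (at x) v) + prod (frechet_derivative f (at x) v) (g x)"])
       (use Suc * assms in \<open>auto intro!: FDERIV Ck_on_add simp flip: frechet_derivative_works\<close>)
qed

lemma (in bounded_linear) Ck_on_linear:
  fixes g :: "'d::euclidean_space \<Rightarrow> 'a"
  assumes "open S"
  shows "Ck_on k g S \<Longrightarrow> Ck_on k (\<lambda>x. f (g x)) S"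
proof (induction k arbitrary: g)
  case 0
  then show ?case by (simp add: continuous_on)
next
  case (Suc k)
  show ?case
    by (rule Ck_on_SucI[OF assms, of _ "\<lambda>x v. f (frechet_derivative g (at x) v)"])
       (use Suc in \<open>auto intro: has_derivative simp flip: frechet_derivative_works\<close>)
qed

lemma Ck_on_sum:
  assumes "open S" "\<And>i. i \<in> A \<Longrightarrow> Ck_on k (f i) S"
  shows "Ck_on k (\<lambda>x. \<Sum>i\<in>A. f i x) S"
proof (cases "finite A")
  case True
  then show ?thesis using assms(2)
    by (induction A) (auto intro: Ck_on_const Ck_on_add assms(1))
qed (simp add: Ck_on_const)

text \<open>The chain rule differentiates \<open>g\<close> in the direction
  \<open>frechet_derivative f (at x) v\<close>, which varies with \<open>x\<close>, whereas
  \<open>Ck_on\<close> speaks of fixed directions. Expanding this direction in the basis gives a sum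
  of products to which the induction hypothesis applies.\<close>

lemma Ck_on_compose:
  assumes "open S"
  shows "Ck_on k f S \<Longrightarrow> Ck_on k g U \<Longrightarrow> f ` S \<subseteq> U \<Longrightarrow> Ck_on k (\<lambda>x. g (f x)) S"
proof (induction k arbitrary: g)
  case 0
  then show ?case by (auto intro: continuous_on_compose2)
next
  case (Suc k)
  have *: "Ck_on k f S" using Suc.prems by (blast intro: Ck_on_SucD)
  have d: "f differentiable (at x)" "g differentiable (at (f x))" if "x \<in> S" for x
    using that Suc.prems by auto
  have D: "((\<lambda>x. g (f x)) has_derivative
      (\<lambda>v. frechet_derivative g (at (f x)) (frechet_derivative f (at x) v))) (at x)"
    if "x \<in> S" for x
    using has_derivative_compose[of f _ x UNIV g] d[OF that] by (auto simp: frechet_derivative_works)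
  have E: "frechet_derivative g (at (f x)) w =
      (\<Sum>b\<in>Basis. (w \<bullet> b) *\<^sub>R frechet_derivative g (at (f x)) b)" if "x \<in> S" for x w
  proof -
    have "linear (frechet_derivative g (at (f x)))"
      using d(2)[OF that] by (rule linear_frechet_derivative)
    then have "frechet_derivative g (at (f x)) (\<Sum>b\<in>Basis. (w \<bullet> b) *\<^sub>R b) =
        (\<Sum>b\<in>Basis. (w \<bullet> b) *\<^sub>R frechet_derivative g (at (f x)) b)"
      by (simp add: linear_sum linear_scale)
    then show ?thesis by (simp add: euclidean_representation)
  qed
  show ?case
  proof (rule Ck_on_SucI[OF assms D])
    fix v
    have "Ck_on k (\<lambda>x. \<Sum>b\<in>Basis. (frechet_derivative f (at x) v \<bullet> b) *\<^sub>R
        frechet_derivative g (at (f x)) b) S"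
      using Suc.prems
      by (intro Ck_on_sum assms bounded_bilinear.Ck_on_bilinear[OF bounded_bilinear_scaleR]
            bounded_linear.Ck_on_linear[OF bounded_linear_inner_left] Suc.IH[OF *]) auto
    then show "Ck_on k (\<lambda>x. frechet_derivative g (at (f x)) (frechet_derivative f (at x) v)) S"
      by (rule Ck_on_cong[OF assms, rotated]) (use E in metis)
  qed auto
qed

text \<open>The exponent is generalized in the induction because one differentiation lowers it to
  \<open>a - 1\<close>.\<close>

lemma Ck_on_powr:
  fixes f :: "_ \<Rightarrow> real"
  assumes "open S" "\<And>x. x \<in> S \<Longrightarrow> f x > 0"
  shows "Ck_on k f S \<Longrightarrow> Ck_on k (\<lambda>x. f x powr a) S"
proof (induction k arbitrary: a)
  case 0
  show ?case
  proof -
    have "\<forall>x\<in>S. f x \<noteq> 0" using assms(2) by (metis less_irrefl)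
    with 0 show ?thesis by (simp add: continuous_on_powr)
  qed
next
  case (Suc k)
  have *: "Ck_on k f S" using Suc.prems by (blast intro: Ck_on_SucD)
  show ?case
  proof (rule Ck_on_SucI[OF assms(1)])
    fix x assume x: "x \<in> S"
    then have f: "(f has_derivative frechet_derivative f (at x)) (at x)"
      using Suc.prems by (simp flip: frechet_derivative_works)
    have "((\<lambda>x. f x powr a) has_derivative (\<lambda>v. frechet_derivative f (at x) v * (a * f x powr (a - 1)))) (at x)"
      using DERIV_compose_FDERIV[OF has_real_derivative_powr[OF assms(2)[OF x]] f] .
    then show "((\<lambda>x. f x powr a) has_derivative (\<lambda>v. frechet_derivative f (at x) v * (a * f x powr (a - 1)))) (at x)" .
  next
    fix v
    show "Ck_on k (\<lambda>x. frechet_derivative f (at x) v * (a * f x powr (a - 1))) S"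
      using Suc.prems
      by (intro bounded_bilinear.Ck_on_bilinear[OF bounded_bilinear_mult] assms Ck_on_const Suc.IH *) auto
  qed
qed

lemma smooth_on_cong:
  "open S \<Longrightarrow> (\<And>x. x \<in> S \<Longrightarrow> f x = g x) \<Longrightarrow> smooth_on f S \<Longrightarrow> smooth_on g S"
  unfolding smooth_on_def by (intro allI, rule Ck_on_cong[of S f g]) auto

lemma smooth_on_local:
  "(\<And>x. x \<in> S \<Longrightarrow> \<exists>U. open U \<and> x \<in> U \<and> smooth_on f U) \<Longrightarrow> smooth_on f S"
  unfolding smooth_on_def by (intro allI Ck_on_local) meson

lemma smooth_on_subset: "smooth_on f S \<Longrightarrow> T \<subseteq> S \<Longrightarrow> smooth_on f T"
  unfolding smooth_on_def by (intro allI, rule Ck_on_subset[of _ f S T]) auto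

lemma smooth_on_const: "smooth_on (\<lambda>x. c) S"
  by (simp add: smooth_on_def Ck_on_const)

lemma smooth_on_add:
  "open S \<Longrightarrow> smooth_on f S \<Longrightarrow> smooth_on g S \<Longrightarrow> smooth_on (\<lambda>x. f x + g x) S"
  by (simp add: smooth_on_def Ck_on_add)

lemma smooth_on_sum:
  "open S \<Longrightarrow> (\<And>i. i \<in> A \<Longrightarrow> smooth_on (f i) S) \<Longrightarrow> smooth_on (\<lambda>x. \<Sum>i\<in>A. f i x) S"
  by (simp add: smooth_on_def Ck_on_sum)

lemma (in bounded_bilinear) smooth_on_bilinear:
  fixes f :: "'d::euclidean_space \<Rightarrow> 'a"
  shows "open S \<Longrightarrow> smooth_on f S \<Longrightarrow> smooth_on g S \<Longrightarrow> smooth_on (\<lambda>x. prod (f x) (g x)) S"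
  by (simp add: smooth_on_def Ck_on_bilinear)

lemmas smooth_on_mult = bounded_bilinear.smooth_on_bilinear[OF bounded_bilinear_mult]
lemmas smooth_on_scaleR = bounded_bilinear.smooth_on_bilinear[OF bounded_bilinear_scaleR]

lemma (in bounded_linear) smooth_on_linear:
  fixes g :: "'d::euclidean_space \<Rightarrow> 'a"
  shows "open S \<Longrightarrow> smooth_on g S \<Longrightarrow> smooth_on (\<lambda>x. f (g x)) S"
  by (simp add: smooth_on_def Ck_on_linear)

lemmas smooth_on_nth = bounded_linear.smooth_on_linear[OF bounded_linear_vec_nth]

lemma smooth_on_vec:
  fixes f :: "'d::euclidean_space \<Rightarrow> 'a::euclidean_space^'n"
  assumes "open S" "\<And>i. smooth_on (\<lambda>x. f x $ i) S"
  shows "smooth_on f S"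
proof -
  have l: "bounded_linear (\<lambda>y::'a. axis i y :: 'a^'n)" for i
    by (intro linear_conv_bounded_linear[THEN iffD1] linearI) (auto simp: axis_def vec_eq_iff)
  have "smooth_on (\<lambda>x. \<Sum>i\<in>UNIV. axis i (f x $ i)) S"
    by (intro smooth_on_sum assms bounded_linear.smooth_on_linear[OF l])
  moreover have "(\<Sum>i\<in>UNIV. axis i (y $ i)) = y" for y :: "'a^'n"
    by (simp add: vec_eq_iff axis_def if_distrib cong: if_cong)
  ultimately show ?thesis by simp
qed

lemma smooth_on_compose:
  "open S \<Longrightarrow> smooth_on f S \<Longrightarrow> smooth_on g U \<Longrightarrow> f ` S \<subseteq> U \<Longrightarrow> smooth_on (\<lambda>x. g (f x)) S"
  by (auto simp: smooth_on_def intro: Ck_on_compose[of S _ f g U])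

lemma smooth_on_powr:
  fixes f :: "_ \<Rightarrow> real"
  shows "open S \<Longrightarrow> (\<And>x. x \<in> S \<Longrightarrow> f x > 0) \<Longrightarrow> smooth_on f S \<Longrightarrow> smooth_on (\<lambda>x. f x powr a) S"
  by (simp add: smooth_on_def Ck_on_powr)

text \<open>The function may be negative while the rule for \<open>powr\<close> asks for a positive
  base, so the power is applied to the square of \<open>f\<close> and one factor \<open>f\<close>
  restores the sign.\<close>

lemma smooth_on_inverse:
  fixes f :: "_ \<Rightarrow> real"
  assumes "open S" "\<And>x. x \<in> S \<Longrightarrow> f x \<noteq> 0" "smooth_on f S"
  shows "smooth_on (\<lambda>x. inverse (f x)) S"
proof -
  have "smooth_on (\<lambda>x. f x * (f x * f x) powr (-1)) S"
    using assms by (intro smooth_on_mult smooth_on_powr) (simp_all flip: power2_eq_square)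
  then show ?thesis
    by (rule smooth_on_cong[OF assms(1), rotated])
       (simp add: powr_minus assms(2))
qed

text \<open>The absolute value disappears on passing to the square, whose power \<open>a/2\<close>
  has a positive base.\<close>

lemma smooth_on_abs_powr:
  fixes f :: "_ \<Rightarrow> real"
  assumes "open S" "\<And>x. x \<in> S \<Longrightarrow> f x \<noteq> 0" "smooth_on f S"
  shows "smooth_on (\<lambda>x. \<bar>f x\<bar> powr a) S"
proof -
  have "smooth_on (\<lambda>x. (f x * f x) powr (a/2)) S"
    using assms by (intro smooth_on_mult smooth_on_powr) (simp_all flip: power2_eq_square)
  moreover have "(y * y) powr (a/2) = \<bar>y\<bar> powr a" if "y \<noteq> 0" for y :: real
  proof -
    have "y * y = \<bar>y\<bar> powr 2" using that by (simp add: power2_eq_square)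
    then show ?thesis by (simp only: powr_powr) simp
  qed
  ultimately show ?thesis
    by (elim smooth_on_cong[OF assms(1), rotated]) (simp add: assms(2))
qed

lemma smooth_on_imp_differentiable: "smooth_on f S \<Longrightarrow> x \<in> S \<Longrightarrow> f differentiable (at x)"
  unfolding smooth_on_def by (drule spec[of _ "Suc 0"]) simp

lemma smooth_on_imp_continuous_on: "smooth_on f S \<Longrightarrow> continuous_on S f"
  unfolding smooth_on_def by (drule spec[of _ 0]) simp

lemma smooth_on_frechet_derivative:
  "smooth_on f S \<Longrightarrow> smooth_on (\<lambda>x. frechet_derivative f (at x) v) S"
  unfolding smooth_on_def
proof
  fix k assume "\<forall>k. Ck_on k f S"
  then have "Ck_on (Suc k) f S" ..
  then show "Ck_on k (\<lambda>x. frechet_derivative f (at x) v) S" by simp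
qed

lemma smooth_on_vector_derivative:
  fixes f :: "real \<Rightarrow> 'b::real_normed_vector"
  assumes "open S" "smooth_on f S"
  shows "smooth_on (\<lambda>t. vector_derivative f (at t)) S"
  by (rule smooth_on_cong[OF assms(1) _ smooth_on_frechet_derivative[OF assms(2), of 1]])
     (use smooth_on_imp_differentiable[OF assms(2)] in \<open>simp only: frechet_derivative_eq_vector_derivative scaleR_one\<close>)

lemma smooth_on_imp_has_vector_derivative:
  "smooth_on f S \<Longrightarrow> t \<in> S \<Longrightarrow> (f has_vector_derivative vector_derivative f (at t)) (at t)"
  using smooth_on_imp_differentiable[of f S t] by (simp only: vector_derivative_works)

lemma smooth_on_imp_DERIV:
  fixes f :: "real \<Rightarrow> real"
  shows "smooth_on f S \<Longrightarrow> t \<in> S \<Longrightarrow> (f has_real_derivative deriv f t) (at t)"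
  by (simp add: DERIV_deriv_iff_real_differentiable smooth_on_imp_differentiable)

lemma smooth_on_deriv:
  fixes f :: "real \<Rightarrow> real"
  assumes "open S" "smooth_on f S"
  shows "smooth_on (deriv f) S"
  by (rule smooth_on_cong[OF assms(1) _ smooth_on_vector_derivative[OF assms]])
     (rule vector_derivative_at,
      simp only: smooth_on_imp_DERIV[OF assms(2)] flip: has_real_derivative_iff_has_vector_derivative)

section \<open>Tangent spaces and the metric in coordinates\<close>

lemma tvec_apply [simp]: "tzero c = 0" "(u +\<^sub>t v) c = u c + v c" "(a *\<^sub>t u) c = a *\<^sub>R u c"
  by (simp_all add: tzero_def tadd_def tscale_def)

lemma linear_vec_expansion:
  fixes f :: "real^'n \<Rightarrow> 'b::real_vector"
  assumes "linear f"
  shows "f x = (\<Sum>i\<in>UNIV. x $ i *\<^sub>R f (axis i 1))"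
proof -
  have "f (\<Sum>i\<in>UNIV. (x $ i) *\<^sub>R axis i 1) = (\<Sum>i\<in>UNIV. x $ i *\<^sub>R f (axis i 1))"
    using assms by (simp add: linear_sum linear_scale)
  then show ?thesis using basis_expansion[of x] by (simp add: scalar_mult_eq_scaleR)
qed

lemma linear_functional_vec:
  fixes f :: "real^'n \<Rightarrow> real"
  assumes "linear f"
  shows "f x = (\<Sum>i\<in>UNIV. x $ i * f (axis i 1))"
  using linear_vec_expansion[OF assms, of x] by simp

lemma inner_matrix_vector_mult:
  fixes A :: "real^'n^'m"
  shows "x \<bullet> (A *v y) = (\<Sum>i\<in>UNIV. \<Sum>j\<in>UNIV. A $ i $ j * (x $ i * y $ j))"
  by (simp add: inner_vec_def matrix_vector_mult_def sum_distrib_left mult.left_commute mult.commute)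

lemma smooth_on_det3:
  fixes A :: "'d::euclidean_space \<Rightarrow> real^3^3"
  assumes "open S" "\<And>i j. smooth_on (\<lambda>x. A x $ i $ j) S"
  shows "smooth_on (\<lambda>x. det (A x)) S"
proof -
  \<comment> \<open>The negative terms are collected under a constant factor -1, so that the sum and
    product rules are enough.\<close>
  have "smooth_on (\<lambda>x. A x $ 1 $ 1 * (A x $ 2 $ 2 * A x $ 3 $ 3) +
    A x $ 1 $ 2 * (A x $ 2 $ 3 * A x $ 3 $ 1) +
    A x $ 1 $ 3 * (A x $ 2 $ 1 * A x $ 3 $ 2) +
    (-1) * (A x $ 1 $ 1 * (A x $ 2 $ 3 * A x $ 3 $ 2) +
    A x $ 1 $ 2 * (A x $ 2 $ 1 * A x $ 3 $ 3) +
    A x $ 1 $ 3 * (A x $ 2 $ 2 * A x $ 3 $ 1))) S"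
    by (intro smooth_on_add smooth_on_mult smooth_on_const assms)
  then show ?thesis
    by (simp add: det_3 algebra_simps)
qed

text \<open>The vectors are the rows, so applying \<open>A\<close> to each is right multiplication
  by \<open>transpose A\<close>. This is the factor that a change of chart contributes to the volume
  form.\<close>

lemma det_vector_matrix_mult:
  fixes A :: "real^3^3"
  shows "det (vector [A *v u, A *v v, A *v w] :: real^3^3) = det A * det (vector [u, v, w] :: real^3^3)"
proof -
  have "(vector [A *v u, A *v v, A *v w] :: real^3^3) = vector [u, v, w] ** transpose A"
    by (simp add: vec_eq_iff matrix_matrix_mult_def matrix_vector_mult_def transpose_def forall_3
          mult.commute)
  then show ?thesis by (simp add: det_mul)
qed

locale oriented_psr3 =
  fixes M :: "'a psr3"
  assumes manifold: "oriented_manifold M"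
    and metric: "pseudo_riemannian_metric M"
begin

lemma charts_atD: "c \<in> charts_at M p \<Longrightarrow> c \<in> atlas M" "c \<in> charts_at M p \<Longrightarrow> p \<in> fst c"
  by (simp_all add: charts_at_def)

lemma
  assumes "c \<in> atlas M"
  shows openin_chart: "openin (points M) (fst c)"
    and open_chart_image: "open (snd c ` fst c)"
    and homeomorphic_chart:
      "homeomorphic_map (subtopology (points M) (fst c)) (top_of_set (snd c ` fst c)) (snd c)"
  using manifold assms by (auto simp: oriented_manifold_def)

lemma chart_at_point:
  assumes "p \<in> topspace (points M)"
  obtains c where "c \<in> charts_at M p"
proof -
  have "p \<in> \<Union> (fst ` atlas M)"
    using manifold assms by (simp add: oriented_manifold_def)
  with that show thesis by (auto simp: charts_at_def)
qed

lemma topspace_chart: "c \<in> charts_at M p \<Longrightarrow> p \<in> topspace (points M)"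
  using openin_subset[OF openin_chart, of c] by (auto simp: charts_at_def)

lemma coord_inv_chart [simp]:
  assumes "c \<in> atlas M" "p \<in> fst c"
  shows "coord_inv c (snd c p) = p"
proof -
  have "inj_on (snd c) (fst c)"
    using homeomorphic_imp_injective_map[OF homeomorphic_chart[OF assms(1)]]
      openin_subset[OF openin_chart[OF assms(1)]]
    by (simp add: Int_absorb1)
  then show ?thesis
    using assms by (simp add: coord_inv_def)
qed

lemma open_chart_image_Int:
  assumes "c \<in> atlas M" "openin (points M) U"
  shows "open (snd c ` (fst c \<inter> U))"
proof -
  have "openin (subtopology (points M) (fst c)) (fst c \<inter> U)"
    using assms openin_subtopology_Int2 by blast
  then have "openin (top_of_set (snd c ` fst c)) (snd c ` (fst c \<inter> U))"
    using homeomorphic_imp_open_map[OF homeomorphic_chart[OF assms(1)]] by (simp add: open_map_def)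
  then show ?thesis
    using open_chart_image[OF assms(1)] openin_open_eq by blast
qed

lemma transition_chart [simp]:
  assumes "c \<in> atlas M" "p \<in> fst c"
  shows "transition c d (snd c p) = snd d p"
  using assms by (simp add: transition_def)

lemma smooth_transition:
  assumes "c \<in> atlas M" "d \<in> atlas M"
  shows "smooth_on (transition c d) (snd c ` (fst c \<inter> fst d))"
  using manifold assms by (auto simp: oriented_manifold_def)

lemma transition_has_derivative:
  assumes "c \<in> charts_at M p" "d \<in> charts_at M p"
  shows "(transition c d has_derivative dtransition c d p) (at (snd c p))"
proof -
  have "transition c d differentiable (at (snd c p))"
    using assms by (intro smooth_on_imp_differentiable[OF smooth_transition]) (auto simp: charts_at_def)
  then show ?thesis
    by (simp add: dtransition_def frechet_derivative_works)
qed

lemma linear_dtransition: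
  "c \<in> charts_at M p \<Longrightarrow> d \<in> charts_at M p \<Longrightarrow> linear (dtransition c d p)"
  using transition_has_derivative has_derivative_linear by blast

lemma dtransition_self:
  assumes "c \<in> charts_at M p"
  shows "dtransition c c p = (\<lambda>x. x)"
proof -
  have "(transition c c has_derivative (\<lambda>x. x)) (at (snd c p))"
    by (rule has_derivative_transform_within_open[OF has_derivative_ident
          open_chart_image[OF charts_atD(1)[OF assms]]])
       (use assms in \<open>auto simp: charts_at_def\<close>)
  then show ?thesis
    using transition_has_derivative[OF assms assms] has_derivative_unique by blast
qed

text \<open>Chain rule for the coordinate changes. The composite agrees with the direct transition
  only on the image of the overlap of \<open>c\<close> and \<open>d\<close>, so the derivatives are
  compared on that open set. This cocycle law is what makes \<open>from_coords\<close> a tangent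
  vector.\<close>

lemma dtransition_compose:
  assumes "c \<in> charts_at M p" "d \<in> charts_at M p" "e \<in> charts_at M p"
  shows "dtransition d e p (dtransition c d p x) = dtransition c e p x"
proof -
  have "((\<lambda>x. transition d e (transition c d x)) has_derivative
      (\<lambda>x. dtransition d e p (dtransition c d p x))) (at (snd c p))"
    using transition_has_derivative[OF assms(1,2)] transition_has_derivative[OF assms(2,3)]
      has_derivative_compose[of "transition c d" _ "snd c p" UNIV "transition d e"] assms(1)
    by (auto simp: charts_at_def)
  then have "(transition c e has_derivative (\<lambda>x. dtransition d e p (dtransition c d p x))) (at (snd c p))"
    by (rule has_derivative_transform_within_open
          [OF _ open_chart_image_Int[OF charts_atD(1)[OF assms(1)] openin_chart[OF charts_atD(1)[OF assms(2)]]]])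
       (use assms in \<open>auto simp: charts_at_def\<close>)
  then show ?thesis
    using transition_has_derivative[OF assms(1,3)] has_derivative_unique by metis
qed

lemma dtransition_tangent:
  "v \<in> tangent_space M p \<Longrightarrow> c \<in> charts_at M p \<Longrightarrow> d \<in> charts_at M p \<Longrightarrow> dtransition c d p (v c) = v d"
  unfolding tangent_space_def mem_Collect_eq by metis

lemma tangent_outside: "v \<in> tangent_space M p \<Longrightarrow> c \<notin> charts_at M p \<Longrightarrow> v c = 0"
  unfolding tangent_space_def by blast

lemma tangentI:
  assumes "\<And>c d. c \<in> charts_at M p \<Longrightarrow> d \<in> charts_at M p \<Longrightarrow> dtransition c d p (v c) = v d"
    and "\<And>c. c \<notin> charts_at M p \<Longrightarrow> v c = 0"
  shows "v \<in> tangent_space M p"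
  unfolding tangent_space_def mem_Collect_eq using assms by metis

lemma from_coords_tangent: "c \<in> charts_at M p \<Longrightarrow> from_coords M c p x \<in> tangent_space M p"
  by (rule tangentI) (simp_all add: from_coords_def dtransition_compose)

lemma from_coords_apply [simp]: "c \<in> charts_at M p \<Longrightarrow> from_coords M c p x c = x"
  by (simp add: from_coords_def dtransition_self)

text \<open>The transformation law carries equality to every other chart around \<open>p\<close>,
  and the default value 0 settles the remaining charts.\<close>

lemma tangent_eqI:
  assumes "u \<in> tangent_space M p" "v \<in> tangent_space M p" "c \<in> charts_at M p" "u c = v c"
  shows "u = v"
proof
  fix d
  show "u d = v d"
    using assms dtransition_tangent[of u p c d] dtransition_tangent[of v p c d]
    by (cases "d \<in> charts_at M p") (auto simp: tangent_outside)
qed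

lemma from_coords_coords:
  assumes "u \<in> tangent_space M p" "c \<in> charts_at M p"
  shows "from_coords M c p (u c) = u"
  using assms by (intro tangent_eqI[OF _ _ assms(2)]) (auto intro: from_coords_tangent)

lemma coord_vec_tangent: "c \<in> charts_at M p \<Longrightarrow> coord_vec M c i p \<in> tangent_space M p"
  by (simp add: coord_vec_def from_coords_tangent)

lemma tadd_tangent:
  "u \<in> tangent_space M p \<Longrightarrow> v \<in> tangent_space M p \<Longrightarrow> u +\<^sub>t v \<in> tangent_space M p"
  by (rule tangentI) (simp_all add: linear_add[OF linear_dtransition] dtransition_tangent tangent_outside)

lemma tscale_tangent: "u \<in> tangent_space M p \<Longrightarrow> a *\<^sub>t u \<in> tangent_space M p"
  by (rule tangentI) (simp_all add: linear_scale[OF linear_dtransition] dtransition_tangent tangent_outside)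

section \<open>The metric as a Gram matrix\<close>

lemma metric_symmetric:
  "p \<in> topspace (points M) \<Longrightarrow> u \<in> tangent_space M p \<Longrightarrow> v \<in> tangent_space M p \<Longrightarrow>
    metric M p u v = metric M p v u"
  using metric unfolding pseudo_riemannian_metric_def by blast

lemma metric_linear_left:
  "p \<in> topspace (points M) \<Longrightarrow> u \<in> tangent_space M p \<Longrightarrow> v \<in> tangent_space M p \<Longrightarrow>
    w \<in> tangent_space M p \<Longrightarrow> metric M p (a *\<^sub>t u +\<^sub>t v) w = a * metric M p u w + metric M p v w"
  using metric unfolding pseudo_riemannian_metric_def by blast

lemma linear_metric_from_coords:
  assumes c: "c \<in> charts_at M p" and w: "w \<in> tangent_space M p"
  shows "linear (\<lambda>x. metric M p (from_coords M c p x) w)"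
proof -
  have *: "metric M p (from_coords M c p (a *\<^sub>R x + y)) w =
      a * metric M p (from_coords M c p x) w + metric M p (from_coords M c p y) w" for a x y
  proof -
    have "from_coords M c p (a *\<^sub>R x + y) = a *\<^sub>t from_coords M c p x +\<^sub>t from_coords M c p y"
      by (rule tangent_eqI[OF _ _ c]) (simp_all add: c from_coords_tangent tadd_tangent tscale_tangent)
    then show ?thesis
      using metric_linear_left[OF topspace_chart[OF c]] c w from_coords_tangent by simp
  qed
  \<comment> \<open>For \<open>a = 1\<close> and zero vectors the identity reads m = m + m. This is
    needed before homogeneity can be split off from the combined linearity law.\<close>
  have z: "metric M p (from_coords M c p 0) w = 0"
    using *[of 1 0 0] by simp
  show ?thesis
    using *[of 1] *[of _ _ 0] z by (intro linearI) auto
qed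

lemma metric_coords:
  assumes u: "u \<in> tangent_space M p" and v: "v \<in> tangent_space M p" and c: "c \<in> charts_at M p"
  shows "metric M p u v = u c \<bullet> (gram M c p *v v c)"
proof -
  have *: "metric M p u w = (\<Sum>i\<in>UNIV. u c $ i * metric M p (coord_vec M c i p) w)"
    if "u \<in> tangent_space M p" "w \<in> tangent_space M p" for u w
    using linear_functional_vec[OF linear_metric_from_coords[OF c that(2)], of "u c"] that c
    by (simp add: from_coords_coords coord_vec_def)
  have "metric M p (coord_vec M c i p) v = (\<Sum>j\<in>UNIV. v c $ j * gram M c p $ i $ j)" for i
    using *[OF v coord_vec_tangent[OF c, of i]] metric_symmetric[OF topspace_chart[OF c]] v c
    by (simp add: coord_vec_tangent gram_def)
  then show ?thesis
    using *[OF u v] by (simp add: inner_matrix_vector_mult sum_distrib_left ac_simps)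
qed

lemma gram_symmetric:
  assumes "c \<in> charts_at M p"
  shows "transpose (gram M c p) = gram M c p"
  using metric_symmetric[OF topspace_chart[OF assms]] coord_vec_tangent[OF assms]
  by (simp add: transpose_def gram_def vec_eq_iff)

lemma inner_gram:
  assumes "c \<in> charts_at M p"
  shows "(gram M c p *v x) \<bullet> y = x \<bullet> (gram M c p *v y)"
  using dot_lmul_matrix[of x "gram M c p" y] gram_symmetric[OF assms]
  by (metis vector_transpose_matrix)

lemma metric_nondegenerate:
  assumes "c \<in> charts_at M p" "u \<in> tangent_space M p"
    and "\<And>w. w \<in> tangent_space M p \<Longrightarrow> metric M p u w = 0"
  shows "u = tzero"
  using metric assms topspace_chart[OF assms(1)] unfolding pseudo_riemannian_metric_def by blast

text \<open>A nonzero kernel vector of the Gram matrix would be the coordinates of a nonzero tangent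
  vector orthogonal to the whole tangent space.\<close>

lemma det_gram_nonzero:
  assumes c: "c \<in> charts_at M p"
  shows "det (gram M c p) \<noteq> 0"
proof
  assume "det (gram M c p) = 0"
  then have "\<not> inj ((*v) (gram M c p))"
    by (simp flip: det_nz_iff_inj_gen)
  then obtain x where x: "gram M c p *v x = 0" "x \<noteq> 0"
    by (auto simp: linear_injective_0[OF matrix_vector_mul_linear])
  have "from_coords M c p x = tzero"
    by (rule metric_nondegenerate[OF c from_coords_tangent[OF c]])
       (use metric_coords[OF from_coords_tangent[OF c] _ c] x c inner_gram[OF c] in
         \<open>metis from_coords_apply inner_zero_left\<close>)
  then show False
    using x from_coords_apply[OF c, of x] by simp
qed

text \<open>The coordinate vectors of \<open>c\<close>, expressed in \<open>d\<close>, are the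
  columns of the Jacobian; the metric evaluated in \<open>d\<close> on these columns is the
  congruence.\<close>

lemma gram_transition:
  assumes c: "c \<in> charts_at M p" and d: "d \<in> charts_at M p"
  shows "gram M c p = transpose (matrix (dtransition c d p)) ** gram M d p ** matrix (dtransition c d p)"
proof -
  let ?J = "matrix (dtransition c d p)"
  have e: "coord_vec M c i p d = dtransition c d p (axis i 1)" for i
    using d by (simp add: coord_vec_def from_coords_def)
  have "gram M c p $ i $ j = axis i 1 \<bullet> ((transpose ?J ** gram M d p ** ?J) *v axis j 1)" for i j
  proof -
    have "gram M c p $ i $ j = dtransition c d p (axis i 1) \<bullet> (gram M d p *v dtransition c d p (axis j 1))"
      unfolding e[symmetric] by (simp add: gram_def metric_coords[OF coord_vec_tangent coord_vec_tangent d] c)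
    also have "\<dots> = (?J *v axis i 1) \<bullet> (gram M d p *v (?J *v axis j 1))"
      by (simp add: linear_dtransition c d)
    also have "\<dots> = axis i 1 \<bullet> (transpose ?J *v (gram M d p *v (?J *v axis j 1)))"
      by (metis dot_lmul_matrix transpose_transpose vector_transpose_matrix)
    finally show ?thesis
      by (simp add: matrix_vector_mul_assoc matrix_mul_assoc)
  qed
  then show ?thesis
    by (simp add: vec_eq_iff inner_axis' matrix_vector_mult_basis column_def)
qed

lemma det_gram_transition:
  assumes "c \<in> charts_at M p" "d \<in> charts_at M p"
  shows "det (gram M c p) = (det (matrix (dtransition c d p)))\<^sup>2 * det (gram M d p)"
  using gram_transition[OF assms] by (simp add: det_mul det_transpose power2_eq_square)

lemma det_dtransition_pos:
  "c \<in> charts_at M p \<Longrightarrow> d \<in> charts_at M p \<Longrightarrow> det (matrix (dtransition c d p)) > 0"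
  using manifold by (auto simp: oriented_manifold_def charts_at_def)

section \<open>Volume form and cross product\<close>

lemma volume_coords:
  assumes "u \<in> tangent_space M p" "v \<in> tangent_space M p" "w \<in> tangent_space M p"
    and c: "c \<in> charts_at M p"
  shows "volume M p u v w = sqrt \<bar>det (gram M c p)\<bar> * det (vector [u c, v c, w c] :: real^3^3)"
proof -
  \<comment> \<open>Independence of the chart: from \<open>c\<close> to \<open>d\<close> the
    component determinant gains the factor det J, while the root of the Gram determinant loses its
    absolute value. These cancel because charts of the atlas have positive Jacobian
    determinants.\<close>
  have *: "sqrt \<bar>det (gram M c p)\<bar> * det (vector [u c, v c, w c] :: real^3^3) =
      sqrt \<bar>det (gram M d p)\<bar> * det (vector [u d, v d, w d] :: real^3^3)"
    if d: "d \<in> charts_at M p" for d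
  proof -
    let ?J = "matrix (dtransition c d p)"
    have "?J *v x c = x d" if "x \<in> tangent_space M p" for x
      using dtransition_tangent[OF that c d] by (simp only: matrix_works linear_dtransition[OF c d] linear_matrix_vector_mul_eq)
    then have "det (vector [u d, v d, w d] :: real^3^3) = det ?J * det (vector [u c, v c, w c] :: real^3^3)"
      using det_vector_matrix_mult[of ?J "u c" "v c" "w c"] assms(1-3) by simp
    moreover have "sqrt \<bar>det (gram M c p)\<bar> = det ?J * sqrt \<bar>det (gram M d p)\<bar>"
      using det_dtransition_pos[OF c d]
      by (simp add: det_gram_transition[OF c d] abs_mult real_sqrt_mult)
    ultimately show ?thesis by simp
  qed
  show ?thesis
    unfolding volume_def by (rule the_equality) (use c * in blast)+
qed

lemma metric_eqI:
  assumes c: "c \<in> charts_at M p" and "u \<in> tangent_space M p" "v \<in> tangent_space M p"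
    and "\<And>z. z \<in> tangent_space M p \<Longrightarrow> metric M p u z = metric M p v z"
  shows "u = v"
proof -
  have p: "p \<in> topspace (points M)" by (rule topspace_chart[OF c])
  have "(-1) *\<^sub>t u +\<^sub>t v = tzero"
    by (rule metric_nondegenerate[OF c])
       (use assms p in \<open>auto simp: metric_linear_left intro: tadd_tangent tscale_tangent\<close>)
  then show ?thesis
    by (auto simp: fun_eq_iff tadd_def tscale_def tzero_def)
qed

text \<open>
  The formula for the coordinates comes from the cofactor identity
  \<open>G (G u \<times> G v) = det G (u \<times> v)\<close> for symmetric \<open>G\<close>.
\<close>

lemma
  assumes u: "u \<in> tangent_space M p" and v: "v \<in> tangent_space M p" and c: "c \<in> charts_at M p"
  shows cross_tangent: "cross M p u v \<in> tangent_space M p"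
    and metric_cross: "z \<in> tangent_space M p \<Longrightarrow> metric M p (cross M p u v) z = volume M p u v z"
    and cross_coords: "cross M p u v c =
      (sqrt \<bar>det (gram M c p)\<bar> / det (gram M c p)) *\<^sub>R cross3 (gram M c p *v u c) (gram M c p *v v c)"
proof -
  let ?G = "gram M c p"
  define x where "x = (sqrt \<bar>det ?G\<bar> / det ?G) *\<^sub>R cross3 (?G *v u c) (?G *v v c)"
  define w where "w = from_coords M c p x"
  have w: "w \<in> tangent_space M p"
    by (simp add: w_def from_coords_tangent c)
  have "?G *v x = sqrt \<bar>det ?G\<bar> *\<^sub>R cross3 (u c) (v c)"
    using cross_matrix_mult[of ?G "u c" "v c"] det_gram_nonzero[OF c]
    by (simp add: x_def matrix_vector_mult_scaleR gram_symmetric[OF c])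
  then have wz: "metric M p w z = volume M p u v z" if "z \<in> tangent_space M p" for z
    using metric_coords[OF w that c] volume_coords[OF u v that c] c
    by (simp add: w_def dot_cross_det[symmetric] inner_gram[OF c, symmetric])
       (simp add: cross3_simps)
  have cross: "cross M p u v = w"
    unfolding cross_def
  proof (rule the_equality)
    fix w' assume "w' \<in> tangent_space M p \<and> (\<forall>z\<in>tangent_space M p. metric M p w' z = volume M p u v z)"
    then show "w' = w"
      using metric_eqI[OF c _ w] wz by auto
  qed (use w wz in auto)
  show "cross M p u v \<in> tangent_space M p"
    by (simp add: cross w)
  show "metric M p (cross M p u v) z = volume M p u v z" if "z \<in> tangent_space M p"
    by (simp add: cross wz that)
  show "cross M p u v c = x"
    by (simp add: cross w_def c)
qed

text \<open>Lagrange's identity. One of the two Gram matrix products is absorbed by the cofactor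
  identity, and the squared normalizing factor times the Gram determinant leaves only its sign. This
  is how the sign of the metric enters \<open>\<epsilon>\<^sub>3\<close>.\<close>

lemma metric_cross_cross:
  assumes u: "u \<in> tangent_space M p" and v: "v \<in> tangent_space M p" and c: "c \<in> charts_at M p"
  shows "metric M p (cross M p u v) (cross M p u v) =
    sgn (det (gram M c p)) * (metric M p u u * metric M p v v - (metric M p u v)\<^sup>2)"
proof -
  let ?G = "gram M c p"
  let ?d = "det ?G" and ?x = "cross3 (?G *v u c) (?G *v v c)"
  have d: "?d \<noteq> 0" by (rule det_gram_nonzero[OF c])
  have "?G *v ?x = ?d *\<^sub>R cross3 (u c) (v c)"
    using cross_matrix_mult[of ?G "u c" "v c"] by (simp add: gram_symmetric[OF c])
  then have "metric M p (cross M p u v) (cross M p u v) =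
      (sqrt \<bar>?d\<bar> / ?d)\<^sup>2 * ?d * (?x \<bullet> cross3 (u c) (v c))"
    using metric_coords[OF cross_tangent[OF u v c] cross_tangent[OF u v c] c]
    by (simp add: cross_coords[OF u v c] matrix_vector_mult_scaleR power2_eq_square)
  also have "(sqrt \<bar>?d\<bar> / ?d)\<^sup>2 * ?d = sgn ?d"
    using d by (simp add: power_divide power2_eq_square sgn_if abs_if)
  also have "?x \<bullet> cross3 (u c) (v c) = ((?G *v u c) \<bullet> u c) * ((?G *v v c) \<bullet> v c) -
      ((?G *v u c) \<bullet> v c) * ((?G *v v c) \<bullet> u c)"
    by (simp add: cross3_simps)
  also have "\<dots> = metric M p u u * metric M p v v - (metric M p u v)\<^sup>2"
    using metric_symmetric[OF topspace_chart[OF c] u v]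
    by (simp add: inner_gram[OF c] metric_coords[OF _ _ c] u v power2_eq_square)
  finally show ?thesis .
qed

section \<open>The sign of the Gram determinant\<close>

lemma smooth_gram:
  assumes "c \<in> atlas M"
  shows "smooth_on (\<lambda>x. gram M c (coord_inv c x) $ i $ j) (snd c ` fst c)"
  using metric assms by (auto simp: pseudo_riemannian_metric_def)

text \<open>Within one chart the set is a preimage under a continuous function, and chart domains
  are open. It is applied to the two half lines to separate the signs.\<close>

lemma openin_det_gram:
  assumes "open A"
  shows "openin (points M) {p. \<exists>c\<in>charts_at M p. det (gram M c p) \<in> A}"
proof (subst openin_subopen, safe)
  fix p c assume c: "c \<in> charts_at M p" and p: "det (gram M c p) \<in> A"
  note cM = charts_atD(1)[OF c]
  let ?f = "\<lambda>x. det (gram M c (coord_inv c x))"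
  let ?T = "{q \<in> fst c. det (gram M c q) \<in> A}"
  have "continuous_on (snd c ` fst c) ?f"
    by (intro smooth_on_imp_continuous_on smooth_on_det3 open_chart_image smooth_gram cM)
  then have "openin (top_of_set (snd c ` fst c)) ((snd c ` fst c) \<inter> ?f -` A)"
    using assms by (simp add: continuous_openin_preimage_gen)
  moreover have "continuous_map (subtopology (points M) (fst c)) (top_of_set (snd c ` fst c)) (snd c)"
    using homeomorphic_imp_continuous_map[OF homeomorphic_chart[OF cM]] .
  ultimately have "openin (subtopology (points M) (fst c))
      {q \<in> topspace (subtopology (points M) (fst c)). snd c q \<in> (snd c ` fst c) \<inter> ?f -` A}"
    by (rule openin_continuous_map_preimage[rotated])
  moreover have "{q \<in> topspace (subtopology (points M) (fst c)). snd c q \<in> (snd c ` fst c) \<inter> ?f -` A} = ?T"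
    using openin_subset[OF openin_chart[OF cM]] cM by (auto dest: coord_inv_chart)
  ultimately have "openin (points M) ?T"
    using openin_trans_full openin_chart[OF cM] by metis
  moreover have "p \<in> ?T"
    using charts_atD(2)[OF c] p by simp
  moreover have "?T \<subseteq> {p. \<exists>c\<in>charts_at M p. det (gram M c p) \<in> A}"
    using cM unfolding charts_at_def by blast
  ultimately show "\<exists>T. openin (points M) T \<and> p \<in> T \<and> T \<subseteq> {p. \<exists>c\<in>charts_at M p. det (gram M c p) \<in> A}"
    by blast
qed

lemma sgn_det_gram_transition:
  assumes "c \<in> charts_at M p" "d \<in> charts_at M p"
  shows "sgn (det (gram M c p)) = sgn (det (gram M d p))"
  using det_gram_transition[OF assms] det_dtransition_pos[OF assms] by (simp add: sgn_mult)

text \<open>Points with positive and with negative Gram determinant form two open sets that cover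
  the manifold. They are disjoint because determinants at a point differ by the square of a Jacobian
  determinant, so connectedness leaves only one of them.\<close>

lemma metric_sign_eq:
  assumes conn: "connected_space (points M)" and c: "c \<in> charts_at M p"
  shows "metric_sign M = sgn (det (gram M c p))"
proof -
  define S where "S A = {p. \<exists>c\<in>charts_at M p. det (gram M c p) \<in> A}" for A
  have SI: "q \<in> S A" if "d \<in> charts_at M q" "det (gram M d q) \<in> A" for d q A
    using that unfolding S_def by blast
  have "openin (points M) (S {0<..})" "openin (points M) (S {..<0})"
    unfolding S_def by (intro openin_det_gram open_greaterThan open_lessThan)+
  moreover have "S {0<..} \<inter> S {..<0} = {}"
  proof -
    have False if "a \<in> charts_at M q" "b \<in> charts_at M q"
      "det (gram M a q) > 0" "det (gram M b q) < 0" for a b q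
      using sgn_det_gram_transition[OF that(1,2)] that by simp
    then show ?thesis unfolding S_def by blast
  qed
  moreover have "topspace (points M) \<subseteq> S {0<..} \<union> S {..<0}"
  proof
    fix q assume "q \<in> topspace (points M)"
    then obtain d where d: "d \<in> charts_at M q" by (rule chart_at_point)
    then have "det (gram M d q) \<in> {0<..} \<or> det (gram M d q) \<in> {..<0}"
      using det_gram_nonzero[OF d] by auto
    with SI[OF d] show "q \<in> S {0<..} \<union> S {..<0}" by blast
  qed
  ultimately have e: "S {0<..} = {} \<or> S {..<0} = {}"
    using conn unfolding connected_space_def by blast
  have *: "sgn (det (gram M d q)) = sgn (det (gram M c p))" if d: "d \<in> charts_at M q" for d q
  proof -
    have "\<not> (det (gram M a x) > 0 \<and> det (gram M b y) < 0)"
      if "a \<in> charts_at M x" "b \<in> charts_at M y" for a b x y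
      using e SI[OF that(1), of "{0<..}"] SI[OF that(2), of "{..<0}"] by auto
    from this[OF c d] this[OF d c] show ?thesis
      using det_gram_nonzero[OF c] det_gram_nonzero[OF d] by (auto simp: sgn_if)
  qed
  show ?thesis
    unfolding metric_sign_def
  proof (rule the_equality)
    show "\<forall>q\<in>topspace (points M). \<forall>d\<in>charts_at M q. sgn (det (gram M d q)) = sgn (det (gram M c p))"
      using * by simp
  next
    fix s assume "\<forall>q\<in>topspace (points M). \<forall>d\<in>charts_at M q. sgn (det (gram M d q)) = s"
    from this[rule_format, OF topspace_chart[OF c] c] show "s = sgn (det (gram M c p))" ..
  qed
qed

end

section \<open>Vector fields along a curve\<close>

lemma has_vector_derivative_chain:
  assumes "(f has_vector_derivative v) (at t)" "(g has_derivative J) (at (f t))"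
  shows "((\<lambda>s. g (f s)) has_vector_derivative J v) (at t)"
proof -
  have "((\<lambda>s. g (f s)) has_derivative (\<lambda>h. J (h *\<^sub>R v))) (at t)"
    using assms has_derivative_compose[of f _ t UNIV g J] by (simp add: has_vector_derivative_def)
  then show ?thesis
    using has_derivative_linear[OF assms(2)] by (simp add: has_vector_derivative_def linear_scale)
qed

lemma bilinear_vec_expansion:
  fixes f :: "real^'m \<Rightarrow> real^'n \<Rightarrow> 'b::real_vector"
  assumes "\<And>y. linear (\<lambda>x. f x y)" "\<And>x. linear (f x)"
  shows "f x y = (\<Sum>i\<in>UNIV. \<Sum>j\<in>UNIV. (x $ i * y $ j) *\<^sub>R f (axis i 1) (axis j 1))"
  using linear_vec_expansion[OF assms(1), of x y] linear_vec_expansion[OF assms(2), of _ y]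
  by (simp add: scaleR_sum_right)

text \<open>As a bilinear map, the connection can be compared with other bilinear or linear
  expressions on basis vectors alone.\<close>

definition christoffel :: "'a connection \<Rightarrow> 'a chart \<Rightarrow> 'a \<Rightarrow> real^3 \<Rightarrow> real^3 \<Rightarrow> real^3" where
  "christoffel D c p u w = (\<Sum>i\<in>UNIV. \<Sum>j\<in>UNIV. (u $ i * w $ j) *\<^sub>R D c p i j)"

lemma linear_christoffel_left: "linear (\<lambda>u. christoffel D c p u w)"
  and linear_christoffel_right: "linear (christoffel D c p u)"
  by (auto intro!: linearI
      simp: christoffel_def algebra_simps sum.distrib scaleR_sum_right scaleR_add_left)

lemma christoffel_axis: "christoffel D c p (axis i 1) (axis j 1) = D c p i j"
  by (simp add: christoffel_def axis_def if_distrib[of "\<lambda>x. x *\<^sub>R _"] if_distrib[of "\<lambda>x. _ * x"]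
      if_distribR cong: if_cong)

locale psr3_curve = oriented_psr3 +
  fixes D :: "'a connection" and I :: "real set" and \<alpha> :: "real \<Rightarrow> 'a"
  assumes levi_civita: "levi_civita M D"
    and open_I: "open I"
    and curve: "smooth_curve M I \<alpha>"
begin

abbreviation chart_times :: "'a chart \<Rightarrow> real set" where
  "chart_times c \<equiv> {t \<in> I. \<alpha> t \<in> fst c}"

abbreviation vderiv :: "(real \<Rightarrow> real^3) \<Rightarrow> real \<Rightarrow> real^3" where
  "vderiv f t \<equiv> vector_derivative f (at t)"

text \<open>The components of a field in a chart make sense only while the curve is in that chart,
  hence smoothness on \<open>chart_times\<close>, one chart at a time.\<close>

definition field_along :: "(real \<Rightarrow> 'a tvec) \<Rightarrow> bool" where
  "field_along X \<longleftrightarrow> (\<forall>t\<in>I. X t \<in> tangent_space M (\<alpha> t)) \<and>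
    (\<forall>c\<in>atlas M. smooth_on (\<lambda>t. X t c) (chart_times c))"

lemma curve_continuous: "continuous_map (top_of_set I) (points M) \<alpha>"
  using curve by (simp add: smooth_curve_def)

lemma curve_point: "t \<in> I \<Longrightarrow> \<alpha> t \<in> topspace (points M)"
  using curve_continuous by (auto simp: continuous_map_def)

lemma curve_chart:
  assumes "t \<in> I"
  obtains c where "c \<in> charts_at M (\<alpha> t)"
  using chart_at_point[OF curve_point[OF assms]] .

lemma open_chart_times:
  assumes "c \<in> atlas M"
  shows "open (chart_times c)"
proof -
  have "openin (top_of_set I) (chart_times c)"
    using openin_continuous_map_preimage[OF curve_continuous openin_chart[OF assms]] by simp
  then show ?thesis
    using open_I openin_open_eq by blast
qed

lemma smooth_coords: "c \<in> atlas M \<Longrightarrow> smooth_on (\<lambda>t. snd c (\<alpha> t)) (chart_times c)"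
  using curve by (auto simp: smooth_curve_def)

lemma charts_at_times: "c \<in> charts_at M (\<alpha> t) \<Longrightarrow> t \<in> I \<Longrightarrow> t \<in> chart_times c"
  by (simp add: charts_at_def)

lemma times_charts_at: "c \<in> atlas M \<Longrightarrow> t \<in> chart_times c \<Longrightarrow> c \<in> charts_at M (\<alpha> t)"
  by (simp add: charts_at_def)

lemma velocity_chart: "c \<in> charts_at M (\<alpha> t) \<Longrightarrow> velocity M \<alpha> t c = vderiv (\<lambda>s. snd c (\<alpha> s)) t"
  by (simp add: velocity_def)

lemma coords_has_derivative:
  assumes "t \<in> I" "c \<in> charts_at M (\<alpha> t)"
  shows "((\<lambda>s. snd c (\<alpha> s)) has_vector_derivative velocity M \<alpha> t c) (at t)"
  using smooth_on_imp_has_vector_derivative[OF smooth_coords charts_at_times] assms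
  by (simp add: velocity_chart charts_atD)

lemma smooth_along_coords:
  assumes "c \<in> atlas M" "smooth_on f (snd c ` fst c)"
  shows "smooth_on (\<lambda>t. f (snd c (\<alpha> t))) (chart_times c)"
  by (rule smooth_on_compose[OF open_chart_times smooth_coords assms(2)]) (use assms(1) in auto)

lemma smooth_gram_along:
  assumes "c \<in> atlas M"
  shows "smooth_on (\<lambda>t. gram M c (\<alpha> t) $ i $ j) (chart_times c)"
  by (rule smooth_on_cong[OF open_chart_times _ smooth_along_coords[OF _ smooth_gram]])
     (use assms in auto)

lemma field_tangent: "field_along X \<Longrightarrow> t \<in> I \<Longrightarrow> X t \<in> tangent_space M (\<alpha> t)"
  by (simp add: field_along_def)

lemma field_smooth: "field_along X \<Longrightarrow> c \<in> atlas M \<Longrightarrow> smooth_on (\<lambda>t. X t c) (chart_times c)"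
  by (simp add: field_along_def)

lemma field_has_derivative:
  assumes "field_along X" "t \<in> I" "c \<in> charts_at M (\<alpha> t)"
  shows "((\<lambda>s. X s c) has_vector_derivative vderiv (\<lambda>s. X s c) t) (at t)"
  using smooth_on_imp_has_vector_derivative[OF field_smooth charts_at_times] assms
  by (simp add: charts_atD)

lemma field_cong:
  assumes "field_along X" "\<And>t. t \<in> I \<Longrightarrow> X t = Y t"
  shows "field_along Y"
  unfolding field_along_def
proof (intro conjI ballI)
  show "Y t \<in> tangent_space M (\<alpha> t)" if "t \<in> I" for t
    using assms that field_tangent by metis
  show "smooth_on (\<lambda>t. Y t c) (chart_times c)" if "c \<in> atlas M" for c
    by (rule smooth_on_cong[OF open_chart_times[OF that] _ field_smooth[OF assms(1) that]])
       (simp add: assms(2))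
qed

text \<open>The transformation law of the velocity is the chain rule for the coordinate change
  composed with the curve, valid for parameters near \<open>t\<close>.\<close>

lemma field_velocity: "field_along (velocity M \<alpha>)"
  unfolding field_along_def
proof (intro conjI ballI)
  fix t assume t: "t \<in> I"
  show "velocity M \<alpha> t \<in> tangent_space M (\<alpha> t)"
  proof (rule tangentI)
    fix c d assume c: "c \<in> charts_at M (\<alpha> t)" and d: "d \<in> charts_at M (\<alpha> t)"
    have "((\<lambda>s. transition c d (snd c (\<alpha> s))) has_vector_derivative
        dtransition c d (\<alpha> t) (velocity M \<alpha> t c)) (at t)"
      by (rule has_vector_derivative_chain[OF coords_has_derivative[OF t c] transition_has_derivative[OF c d]])
    then have "((\<lambda>s. snd d (\<alpha> s)) has_vector_derivative
        dtransition c d (\<alpha> t) (velocity M \<alpha> t c)) (at t)"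
      by (rule has_vector_derivative_transform_within_open
            [OF _ open_chart_times[OF charts_atD(1)[OF c]] charts_at_times[OF c t]])
         (use c in \<open>simp add: charts_at_def\<close>)
    then show "dtransition c d (\<alpha> t) (velocity M \<alpha> t c) = velocity M \<alpha> t d"
      using vector_derivative_unique_at coords_has_derivative[OF t d] by blast
  qed (simp add: velocity_def)
next
  fix c assume c: "c \<in> atlas M"
  show "smooth_on (\<lambda>t. velocity M \<alpha> t c) (chart_times c)"
    by (rule smooth_on_cong[OF open_chart_times[OF c] _
          smooth_on_vector_derivative[OF open_chart_times[OF c] smooth_coords[OF c]]])
       (simp add: velocity_chart times_charts_at c)
qed

section \<open>Covariant differentiation along the curve\<close>

lemma covd_chart:
  "c \<in> charts_at M (\<alpha> t) \<Longrightarrow> covd M D \<alpha> X t c =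
    vderiv (\<lambda>s. X s c) t + christoffel D c (\<alpha> t) (velocity M \<alpha> t c) (X t c)"
  by (simp add: covd_def christoffel_def)

lemma connection_affine: "affine_connection M D"
  using levi_civita by (simp add: levi_civita_def)

lemma smooth_connection_along:
  assumes "c \<in> atlas M"
  shows "smooth_on (\<lambda>t. D c (\<alpha> t) i j) (chart_times c)"
proof -
  have "smooth_on (\<lambda>x. D c (coord_inv c x) i j) (snd c ` fst c)"
    using connection_affine assms by (simp add: affine_connection_def)
  from smooth_along_coords[OF assms this] show ?thesis
    by (rule smooth_on_cong[OF open_chart_times[OF assms], rotated]) (use assms in auto)
qed

text \<open>Near \<open>t\<close> the components in \<open>d\<close> are the Jacobian along the
  curve applied to those in \<open>c\<close>. Its columns are the first partial derivatives of the
  transition, so the product rule leaves second partial derivatives as the defect from being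
  tensorial.\<close>

lemma field_derivative_transition:
  assumes X: "field_along X" and t: "t \<in> I"
    and c: "c \<in> charts_at M (\<alpha> t)" and d: "d \<in> charts_at M (\<alpha> t)"
  shows "vderiv (\<lambda>s. X s d) t = dtransition c d (\<alpha> t) (vderiv (\<lambda>s. X s c) t) +
    (\<Sum>i\<in>UNIV. \<Sum>j\<in>UNIV. (velocity M \<alpha> t c $ i * X t c $ j) *\<^sub>R
      partial i (partial j (transition c d)) (snd c (\<alpha> t)))"
proof -
  let ?x = "\<lambda>s. snd c (\<alpha> s)" and ?P = "\<lambda>j. partial j (transition c d)"
  let ?v = "velocity M \<alpha> t c" and ?X' = "vderiv (\<lambda>s. X s c) t"
  have cd: "c \<in> atlas M" "d \<in> atlas M" using c d by (auto simp: charts_at_def)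
  have P: "(?P j has_derivative frechet_derivative (?P j) (at (?x t))) (at (?x t))" for j
    unfolding partial_def frechet_derivative_works[symmetric]
    by (rule smooth_on_imp_differentiable
          [OF smooth_on_frechet_derivative[OF smooth_transition[OF cd]]])
       (use c d in \<open>simp add: charts_at_def\<close>)
  have "((\<lambda>s. ?P j (?x s)) has_vector_derivative frechet_derivative (?P j) (at (?x t)) ?v) (at t)" for j
    by (rule has_vector_derivative_chain[OF coords_has_derivative[OF t c] P])
  moreover have "frechet_derivative (?P j) (at (?x t)) ?v = (\<Sum>i\<in>UNIV. ?v $ i *\<^sub>R partial i (?P j) (?x t))" for j
    using linear_vec_expansion[OF has_derivative_linear[OF P], of _ ?v] by (simp only: partial_def)
  ultimately have Px: "((\<lambda>s. ?P j (?x s)) has_vector_derivative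
      (\<Sum>i\<in>UNIV. ?v $ i *\<^sub>R partial i (?P j) (?x t))) (at t)" for j
    by simp
  have Xj: "((\<lambda>s. X s c $ j) has_real_derivative ?X' $ j) (at t)" for j
    using bounded_linear.has_vector_derivative[OF bounded_linear_vec_nth field_has_derivative[OF X t c]]
    by (simp add: has_real_derivative_iff_has_vector_derivative)
  have "((\<lambda>s. \<Sum>j\<in>UNIV. X s c $ j *\<^sub>R ?P j (?x s)) has_vector_derivative
      (\<Sum>j\<in>UNIV. X t c $ j *\<^sub>R (\<Sum>i\<in>UNIV. ?v $ i *\<^sub>R partial i (?P j) (?x t)) + ?X' $ j *\<^sub>R ?P j (?x t))) (at t)"
    by (intro has_vector_derivative_sum has_vector_derivative_scaleR Xj Px)
  moreover have E: "dtransition c d p y = (\<Sum>j\<in>UNIV. y $ j *\<^sub>R ?P j (snd c p))"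
    if "c \<in> charts_at M p" "d \<in> charts_at M p" for p y
    using linear_vec_expansion[OF linear_dtransition[OF that], of y] by (simp only: partial_def dtransition_def)
  have "open (chart_times c \<inter> chart_times d)"
    using cd by (intro open_Int open_chart_times)
  ultimately have "((\<lambda>s. X s d) has_vector_derivative
      (\<Sum>j\<in>UNIV. X t c $ j *\<^sub>R (\<Sum>i\<in>UNIV. ?v $ i *\<^sub>R partial i (?P j) (?x t)) + ?X' $ j *\<^sub>R ?P j (?x t))) (at t)"
  proof (rule has_vector_derivative_transform_within_open)
    show "t \<in> chart_times c \<inter> chart_times d" using c d t by (simp add: charts_at_def)
    fix s assume s: "s \<in> chart_times c \<inter> chart_times d"
    then have s': "s \<in> I" "c \<in> charts_at M (\<alpha> s)" "d \<in> charts_at M (\<alpha> s)"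
      using cd by (auto simp: charts_at_def)
    show "(\<Sum>j\<in>UNIV. X s c $ j *\<^sub>R ?P j (?x s)) = X s d"
      using dtransition_tangent[OF field_tangent[OF X s'(1)] s'(2,3)] E[OF s'(2,3), of "X s c"] by simp
  qed
  then have "vderiv (\<lambda>s. X s d) t = (\<Sum>j\<in>UNIV. \<Sum>i\<in>UNIV. (?v $ i * X t c $ j) *\<^sub>R partial i (?P j) (?x t)) +
      dtransition c d (\<alpha> t) ?X'"
    by (simp add: vector_derivative_at E[OF c d] sum.distrib scaleR_sum_right mult.commute)
  then show ?thesis
    by (subst sum.swap) simp
qed

text \<open>Bilinear extension of the transformation law, which is assumed only for pairs of
  coordinate directions.\<close>

lemma christoffel_transition:
  assumes c: "c \<in> charts_at M p" and d: "d \<in> charts_at M p"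
  shows "dtransition c d p (christoffel D c p u w) =
    christoffel D d p (dtransition c d p u) (dtransition c d p w) +
    (\<Sum>i\<in>UNIV. \<Sum>j\<in>UNIV. (u $ i * w $ j) *\<^sub>R partial i (partial j (transition c d)) (snd c p))"
proof -
  let ?J = "dtransition c d p"
  note J = linear_dtransition[OF c d]
  have "christoffel D d p (?J u) (?J w) =
      (\<Sum>i\<in>UNIV. \<Sum>j\<in>UNIV. (u $ i * w $ j) *\<^sub>R christoffel D d p (?J (axis i 1)) (?J (axis j 1)))"
    using linear_compose[OF J linear_christoffel_left] linear_compose[OF J linear_christoffel_right]
    by (intro bilinear_vec_expansion) (simp_all add: o_def)
  moreover have "?J (D c p i j) = christoffel D d p (?J (axis i 1)) (?J (axis j 1)) +
      partial i (partial j (transition c d)) (snd c p)" for i j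
    using connection_affine c d unfolding affine_connection_def christoffel_def charts_at_def by blast
  ultimately show ?thesis
    by (simp add: christoffel_def[of D c] linear_sum[OF J] linear_scale[OF J] scaleR_add_right sum.distrib)
qed

text \<open>The second partial derivatives of the transition that arise from the component
  derivative are exactly those in the transformation law of the Christoffel term, so the sum of both
  terms is tensorial.\<close>

lemma field_covd:
  assumes X: "field_along X"
  shows "field_along (covd M D \<alpha> X)"
  unfolding field_along_def
proof (intro conjI ballI)
  fix t assume t: "t \<in> I"
  show "covd M D \<alpha> X t \<in> tangent_space M (\<alpha> t)"
  proof (rule tangentI)
    fix c d assume c: "c \<in> charts_at M (\<alpha> t)" and d: "d \<in> charts_at M (\<alpha> t)"
    show "dtransition c d (\<alpha> t) (covd M D \<alpha> X t c) = covd M D \<alpha> X t d"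
      using dtransition_tangent[OF field_tangent[OF X t] c d]
        dtransition_tangent[OF field_tangent[OF field_velocity t] c d]
      by (simp add: covd_chart c d field_derivative_transition[OF X t c d]
          christoffel_transition[OF c d] linear_add[OF linear_dtransition[OF c d]])
  qed (simp add: covd_def)
next
  fix c assume c: "c \<in> atlas M"
  have "smooth_on (\<lambda>t. vderiv (\<lambda>s. X s c) t +
      (\<Sum>i\<in>UNIV. \<Sum>j\<in>UNIV. (velocity M \<alpha> t c $ i * X t c $ j) *\<^sub>R D c (\<alpha> t) i j)) (chart_times c)"
    using c X
    by (intro smooth_on_add smooth_on_vector_derivative smooth_on_sum smooth_on_scaleR smooth_on_mult
        smooth_on_nth open_chart_times field_smooth smooth_connection_along field_velocity)
  then show "smooth_on (\<lambda>t. covd M D \<alpha> X t c) (chart_times c)"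
    by (rule smooth_on_cong[OF open_chart_times[OF c], rotated])
       (simp add: covd_def times_charts_at c)
qed

lemma covd_cong:
  assumes X: "field_along X" and "\<And>s. s \<in> I \<Longrightarrow> X s = Y s" and t: "t \<in> I"
  shows "covd M D \<alpha> X t = covd M D \<alpha> Y t"
proof
  fix c
  have "vderiv (\<lambda>s. X s c) t = vderiv (\<lambda>s. Y s c) t" if c: "c \<in> charts_at M (\<alpha> t)"
    by (rule vector_derivative_at[symmetric],
        rule has_vector_derivative_transform_within_open[OF field_has_derivative[OF X t c] open_I t])
       (simp add: assms(2))
  then show "covd M D \<alpha> X t c = covd M D \<alpha> Y t c"
    using assms(2)[OF t] by (simp add: covd_def)
qed

lemma field_add:
  assumes "field_along X" "field_along Y"
  shows "field_along (\<lambda>t. X t +\<^sub>t Y t)"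
  using assms by (simp add: field_along_def tadd_tangent smooth_on_add open_chart_times)

lemma field_scale:
  assumes "smooth_on f I" "field_along X"
  shows "field_along (\<lambda>t. f t *\<^sub>t X t)"
  using assms smooth_on_subset[OF assms(1)]
  by (simp add: field_along_def tscale_tangent smooth_on_scaleR open_chart_times)

lemma covd_add:
  assumes X: "field_along X" and Y: "field_along Y" and t: "t \<in> I"
  shows "covd M D \<alpha> (\<lambda>t. X t +\<^sub>t Y t) t = covd M D \<alpha> X t +\<^sub>t covd M D \<alpha> Y t"
proof
  fix c
  show "covd M D \<alpha> (\<lambda>t. X t +\<^sub>t Y t) t c = (covd M D \<alpha> X t +\<^sub>t covd M D \<alpha> Y t) c"
  proof (cases "c \<in> charts_at M (\<alpha> t)")
    case c: True
    show ?thesis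
      using has_vector_derivative_add[OF field_has_derivative[OF X t c] field_has_derivative[OF Y t c]]
      by (simp add: covd_chart c vector_derivative_at linear_add[OF linear_christoffel_right])
  qed (simp add: covd_def)
qed

lemma covd_scale:
  assumes f: "(f has_real_derivative f') (at t)" and X: "field_along X" and t: "t \<in> I"
  shows "covd M D \<alpha> (\<lambda>t. f t *\<^sub>t X t) t = f' *\<^sub>t X t +\<^sub>t f t *\<^sub>t covd M D \<alpha> X t"
proof
  fix c
  show "covd M D \<alpha> (\<lambda>t. f t *\<^sub>t X t) t c = (f' *\<^sub>t X t +\<^sub>t f t *\<^sub>t covd M D \<alpha> X t) c"
  proof (cases "c \<in> charts_at M (\<alpha> t)")
    case c: True
    show ?thesis
      using has_vector_derivative_scaleR[OF f field_has_derivative[OF X t c]]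
      by (simp add: covd_chart c vector_derivative_at linear_scale[OF linear_christoffel_right]
          scaleR_add_right)
  \<comment> \<open>In a chart not containing the point, \<open>covd\<close> is 0 by convention; the
    right side is 0 there because \<open>X t\<close> is a tangent vector.\<close>
  qed (simp add: covd_def tangent_outside[OF field_tangent[OF X t]])
qed

section \<open>Scalar and cross products of fields along the curve\<close>

lemma smooth_metric:
  assumes X: "field_along X" and Y: "field_along Y"
  shows "smooth_on (\<lambda>t. metric M (\<alpha> t) (X t) (Y t)) I"
proof (rule smooth_on_local)
  fix t assume t: "t \<in> I"
  obtain c where c: "c \<in> charts_at M (\<alpha> t)" by (rule curve_chart[OF t])
  note cM = charts_atD(1)[OF c]
  have "smooth_on (\<lambda>t. \<Sum>i\<in>UNIV. \<Sum>j\<in>UNIV. gram M c (\<alpha> t) $ i $ j * (X t c $ i * Y t c $ j)) (chart_times c)"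
    using cM X Y
    by (intro smooth_on_sum smooth_on_mult smooth_on_nth open_chart_times field_smooth smooth_gram_along)
  then have "smooth_on (\<lambda>t. metric M (\<alpha> t) (X t) (Y t)) (chart_times c)"
    by (rule smooth_on_cong[OF open_chart_times[OF cM], rotated])
       (simp add: metric_coords[OF field_tangent[OF X] field_tangent[OF Y] times_charts_at[OF cM]]
          inner_matrix_vector_mult)
  then show "\<exists>U. open U \<and> t \<in> U \<and> smooth_on (\<lambda>t. metric M (\<alpha> t) (X t) (Y t)) U"
    using open_chart_times[OF cM] charts_at_times[OF c t] by blast
qed

lemma field_cross:
  assumes X: "field_along X" and Y: "field_along Y"
  shows "field_along (\<lambda>t. cross M (\<alpha> t) (X t) (Y t))"
  unfolding field_along_def
proof (intro conjI ballI)
  fix t assume t: "t \<in> I"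
  obtain c where "c \<in> charts_at M (\<alpha> t)" by (rule curve_chart[OF t])
  then show "cross M (\<alpha> t) (X t) (Y t) \<in> tangent_space M (\<alpha> t)"
    using X Y t by (intro cross_tangent field_tangent)
next
  fix c assume c: "c \<in> atlas M"
  let ?G = "\<lambda>t. gram M c (\<alpha> t)"
  note O = open_chart_times[OF c]
  have G: "smooth_on (\<lambda>t. ?G t *v Z t c) (chart_times c)" if "field_along Z" for Z
    unfolding matrix_vector_mult_def using c that
    by (intro smooth_on_vec O)
       (simp, intro smooth_on_sum smooth_on_mult smooth_on_nth O field_smooth smooth_gram_along)
  have d: "smooth_on (\<lambda>t. det (?G t)) (chart_times c)"
    using c by (intro smooth_on_det3 O smooth_gram_along)
  have nz: "det (?G t) \<noteq> 0" if "t \<in> chart_times c" for t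
    using det_gram_nonzero[OF times_charts_at[OF c that]] .
  \<comment> \<open>The square root is written as a power of an absolute value, to which
    \<open>smooth_on_abs_powr\<close> applies since the Gram determinant does not vanish.\<close>
  have "smooth_on (\<lambda>t. (\<bar>det (?G t)\<bar> powr (1/2) * inverse (det (?G t))) *\<^sub>R
      cross3 (?G t *v X t c) (?G t *v Y t c)) (chart_times c)"
    by (intro smooth_on_scaleR smooth_on_mult smooth_on_abs_powr smooth_on_inverse O d nz G X Y
        bounded_bilinear.smooth_on_bilinear[OF bilinear_conv_bounded_bilinear[THEN iffD1, OF bilinear_cross]])
  then show "smooth_on (\<lambda>t. cross M (\<alpha> t) (X t) (Y t) c) (chart_times c)"
  proof (rule smooth_on_cong[OF O, rotated])
    fix t assume t: "t \<in> chart_times c"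
    then have "t \<in> I" by simp
    from cross_coords[OF field_tangent[OF X this] field_tangent[OF Y this] times_charts_at[OF c t]]
    show "(\<bar>det (?G t)\<bar> powr (1/2) * inverse (det (?G t))) *\<^sub>R
        cross3 (?G t *v X t c) (?G t *v Y t c) = cross M (\<alpha> t) (X t) (Y t) c"
      by (simp only: powr_half_sqrt abs_ge_zero divide_inverse[of "sqrt _"])
  qed
qed

text \<open>\<open>levi_civita\<close> gives this for coordinate directions. Both sides are linear
  in the direction, so it passes to the velocity.\<close>

lemma metric_compatible:
  assumes t: "t \<in> I" and c: "c \<in> charts_at M (\<alpha> t)"
  shows "((\<lambda>s. gram M c (\<alpha> s) $ i $ j) has_real_derivative
    christoffel D c (\<alpha> t) (velocity M \<alpha> t c) (axis i 1) \<bullet> (gram M c (\<alpha> t) *v axis j 1) +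
    axis i 1 \<bullet> (gram M c (\<alpha> t) *v christoffel D c (\<alpha> t) (velocity M \<alpha> t c) (axis j 1))) (at t)"
proof -
  let ?p = "\<alpha> t" and ?x = "\<lambda>s. snd c (\<alpha> s)" and ?v = "velocity M \<alpha> t c"
  let ?G = "gram M c (\<alpha> t)" and ?\<Gamma> = "christoffel D c (\<alpha> t)"
  let ?g = "\<lambda>x. gram M c (coord_inv c x) $ i $ j"
  note cM = charts_atD[OF c]
  have g: "(?g has_derivative frechet_derivative ?g (at (?x t))) (at (?x t))"
    unfolding frechet_derivative_works[symmetric]
    by (rule smooth_on_imp_differentiable[OF smooth_gram[OF cM(1)]]) (use cM in auto)
  have "((\<lambda>s. ?g (?x s)) has_vector_derivative frechet_derivative ?g (at (?x t)) ?v) (at t)"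
    by (rule has_vector_derivative_chain[OF coords_has_derivative[OF t c] g])
  then have "((\<lambda>s. gram M c (\<alpha> s) $ i $ j) has_vector_derivative frechet_derivative ?g (at (?x t)) ?v) (at t)"
    by (rule has_vector_derivative_transform_within_open
          [OF _ open_chart_times[OF cM(1)] charts_at_times[OF c t]])
       (simp add: cM(1))
  moreover have "frechet_derivative ?g (at (?x t)) ?v =
      ?\<Gamma> ?v (axis i 1) \<bullet> (?G *v axis j 1) + axis i 1 \<bullet> (?G *v ?\<Gamma> ?v (axis j 1))"
  proof -
    have "frechet_derivative ?g (at (?x t)) (axis k 1) =
        D c ?p k i \<bullet> (?G *v axis j 1) + axis i 1 \<bullet> (?G *v D c ?p k j)" for k
    proof -
      have "partial k ?g (?x t) = metric M ?p (from_coords M c ?p (D c ?p k i)) (coord_vec M c j ?p) +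
           metric M ?p (coord_vec M c i ?p) (from_coords M c ?p (D c ?p k j))"
        using levi_civita cM unfolding levi_civita_def by blast
      then show ?thesis
        using c by (simp add: partial_def coord_vec_def metric_coords[OF from_coords_tangent from_coords_tangent])
    qed
    moreover have "linear (\<lambda>v. ?\<Gamma> v (axis i 1) \<bullet> (?G *v axis j 1) + axis i 1 \<bullet> (?G *v ?\<Gamma> v (axis j 1)))"
      by (intro linearI) (simp_all add: linear_add[OF linear_christoffel_left]
          linear_scale[OF linear_christoffel_left] inner_add_left inner_add_right
          matrix_vector_right_distrib matrix_vector_mult_scaleR algebra_simps)
    note linear_functional_vec[OF this, of ?v]
    ultimately show ?thesis
      using linear_functional_vec[OF has_derivative_linear[OF g], of ?v]
      by (simp add: christoffel_axis)
  qed
  ultimately show ?thesis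
    by (simp add: has_real_derivative_iff_has_vector_derivative)
qed

text \<open>Product rule for the coordinate sum: by metric compatibility, differentiating the Gram
  entries supplies the Christoffel terms that turn component derivatives into covariant
  ones.\<close>

lemma metric_has_derivative:
  assumes X: "field_along X" and Y: "field_along Y" and t: "t \<in> I"
  shows "((\<lambda>s. metric M (\<alpha> s) (X s) (Y s)) has_real_derivative
    metric M (\<alpha> t) (covd M D \<alpha> X t) (Y t) + metric M (\<alpha> t) (X t) (covd M D \<alpha> Y t)) (at t)"
proof -
  obtain c where c: "c \<in> charts_at M (\<alpha> t)" by (rule curve_chart[OF t])
  note cM = charts_atD(1)[OF c]
  let ?G = "gram M c (\<alpha> t)" and ?\<Gamma> = "christoffel D c (\<alpha> t) (velocity M \<alpha> t c)"
  let ?E = "\<lambda>i j. ?\<Gamma> (axis i 1) \<bullet> (?G *v axis j 1) + axis i 1 \<bullet> (?G *v ?\<Gamma> (axis j 1))"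
  let ?X = "X t c" and ?Y = "Y t c" and ?X' = "vderiv (\<lambda>s. X s c) t" and ?Y' = "vderiv (\<lambda>s. Y s c) t"
  have comp: "((\<lambda>s. Z s c $ j) has_real_derivative vderiv (\<lambda>s. Z s c) t $ j) (at t)"
    if "field_along Z" for Z j
    using bounded_linear.has_vector_derivative[OF bounded_linear_vec_nth field_has_derivative[OF that t c]]
    by (simp add: has_real_derivative_iff_has_vector_derivative)
  have "((\<lambda>s. \<Sum>i\<in>UNIV. \<Sum>j\<in>UNIV. gram M c (\<alpha> s) $ i $ j * (X s c $ i * Y s c $ j)) has_real_derivative
     (\<Sum>i\<in>UNIV. \<Sum>j\<in>UNIV. ?E i j * (?X $ i * ?Y $ j) +
       (?X' $ i * ?Y $ j + ?Y' $ j * ?X $ i) * ?G $ i $ j)) (at t)"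
    by (intro DERIV_sum DERIV_mult metric_compatible[OF t c] comp X Y)
  then have "((\<lambda>s. metric M (\<alpha> s) (X s) (Y s)) has_real_derivative
     (\<Sum>i\<in>UNIV. \<Sum>j\<in>UNIV. ?E i j * (?X $ i * ?Y $ j) +
       (?X' $ i * ?Y $ j + ?Y' $ j * ?X $ i) * ?G $ i $ j)) (at t)"
  proof (rule has_field_derivative_transform_within_open[OF _ open_chart_times[OF cM] charts_at_times[OF c t]])
    fix s assume s: "s \<in> chart_times c"
    then have "s \<in> I" by simp
    from metric_coords[OF field_tangent[OF X this] field_tangent[OF Y this] times_charts_at[OF cM s]]
    show "(\<Sum>i\<in>UNIV. \<Sum>j\<in>UNIV. gram M c (\<alpha> s) $ i $ j * (X s c $ i * Y s c $ j)) =
      metric M (\<alpha> s) (X s) (Y s)"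
      by (simp add: inner_matrix_vector_mult)
  qed
  moreover have "(\<Sum>i\<in>UNIV. \<Sum>j\<in>UNIV. ?E i j * (?X $ i * ?Y $ j) +
       (?X' $ i * ?Y $ j + ?Y' $ j * ?X $ i) * ?G $ i $ j) =
     (\<Sum>i\<in>UNIV. \<Sum>j\<in>UNIV. (?X $ i * ?Y $ j) *\<^sub>R ?E i j) + ?X' \<bullet> (?G *v ?Y) + ?X \<bullet> (?G *v ?Y')"
    by (simp add: inner_matrix_vector_mult[of ?X'] inner_matrix_vector_mult[of ?X] sum.distrib[symmetric]
        algebra_simps)
  moreover have "(\<Sum>i\<in>UNIV. \<Sum>j\<in>UNIV. (?X $ i * ?Y $ j) *\<^sub>R ?E i j) =
      ?\<Gamma> ?X \<bullet> (?G *v ?Y) + ?X \<bullet> (?G *v ?\<Gamma> ?Y)"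
    by (rule bilinear_vec_expansion[symmetric, where f = "\<lambda>x y. ?\<Gamma> x \<bullet> (?G *v y) + x \<bullet> (?G *v ?\<Gamma> y)"];
        intro linearI)
       (simp_all add: linear_add[OF linear_christoffel_right] linear_scale[OF linear_christoffel_right]
          inner_add_left inner_add_right matrix_vector_right_distrib matrix_vector_mult_scaleR algebra_simps)
  ultimately show ?thesis
    using c X Y t
    by (simp add: metric_coords[OF _ _ c] field_tangent field_covd covd_chart inner_add_left
        inner_add_right matrix_vector_right_distrib algebra_simps)
qed

end

section \<open>The Frenet equations\<close>

context oriented_psr3
begin

lemma metric_add:
  assumes "c \<in> charts_at M p" "u \<in> tangent_space M p" "v \<in> tangent_space M p" "w \<in> tangent_space M p"
  shows "metric M p (u +\<^sub>t v) w = metric M p u w + metric M p v w"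
    and "metric M p w (u +\<^sub>t v) = metric M p w u + metric M p w v"
  using assms
  by (simp_all add: metric_coords[OF _ _ assms(1)] tadd_tangent inner_add_left inner_add_right
      matrix_vector_right_distrib)

lemma metric_scale:
  assumes "c \<in> charts_at M p" "u \<in> tangent_space M p" "w \<in> tangent_space M p"
  shows "metric M p (a *\<^sub>t u) w = a * metric M p u w"
    and "metric M p w (a *\<^sub>t u) = a * metric M p w u"
  using assms
  by (simp_all add: metric_coords[OF _ _ assms(1)] tscale_tangent matrix_vector_mult_scaleR)

text \<open>The three scalar products say that the matrix with rows \<open>u\<close>,
  \<open>v\<close>, \<open>w\<close> times the Gram matrix annihilates the difference of components.
  The first factor is invertible by the volume, the second by nondegeneracy.\<close>

lemma frame_eqI:
  assumes c: "c \<in> charts_at M p"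
    and T: "u \<in> tangent_space M p" "v \<in> tangent_space M p" "w \<in> tangent_space M p"
      "x \<in> tangent_space M p" "y \<in> tangent_space M p"
    and vol: "volume M p u v w \<noteq> 0"
    and eq: "metric M p u x = metric M p u y" "metric M p v x = metric M p v y"
      "metric M p w x = metric M p w y"
  shows "x = y"
proof -
  let ?G = "gram M c p" and ?P = "vector [u c, v c, w c] :: real^3^3"
  have "z c \<bullet> (?G *v (x c - y c)) = metric M p z x - metric M p z y" if "z \<in> tangent_space M p" for z
    using that T by (simp add: metric_coords[OF _ _ c] matrix_vector_mult_diff_distrib inner_diff_right)
  then have "?P *v (?G *v (x c - y c)) = 0"
    using T eq by (simp add: vec_eq_iff forall_3 matrix_vector_mul_component)
  moreover have "det ?P \<noteq> 0"
    using vol volume_coords[OF T(1-3) c] by auto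
  then have "inj ((*v) ?P)" "inj ((*v) ?G)"
    using det_gram_nonzero[OF c] by (simp_all flip: det_nz_iff_inj_gen)
  ultimately have "x c - y c = 0"
    unfolding linear_injective_0[OF matrix_vector_mul_linear] by blast
  then have "x c = y c" by (rule eq_iff_diff_eq_0[THEN iffD2])
  then show ?thesis
    by (rule tangent_eqI[OF T(4,5) c])
qed

lemma volume_same:
  "u \<in> tangent_space M p \<Longrightarrow> v \<in> tangent_space M p \<Longrightarrow> c \<in> charts_at M p \<Longrightarrow> volume M p u v u = 0"
  "u \<in> tangent_space M p \<Longrightarrow> v \<in> tangent_space M p \<Longrightarrow> c \<in> charts_at M p \<Longrightarrow> volume M p u v v = 0"
  by (simp_all add: volume_coords det_3)

lemma volume_scale_combination:
  assumes "c \<in> charts_at M p" "u \<in> tangent_space M p" "v \<in> tangent_space M p" "w \<in> tangent_space M p"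
  shows "volume M p u (a *\<^sub>t v) (b *\<^sub>t v +\<^sub>t d *\<^sub>t w) = a * d * volume M p u v w"
  using assms
  by (simp add: volume_coords[OF _ _ _ assms(1)] tscale_tangent tadd_tangent det_3 algebra_simps)

end

text \<open>The image is an interval without 0. This makes the definite description of
  \<open>\<epsilon>\<^sub>2\<close> meaningful.\<close>

lemma continuous_nonzero_sgn_constant:
  fixes f :: "real \<Rightarrow> real"
  assumes "is_interval I" "continuous_on I f" "\<And>t. t \<in> I \<Longrightarrow> f t \<noteq> 0" "s \<in> I" "t \<in> I"
  shows "sgn (f s) = sgn (f t)"
proof -
  have i: "is_interval (f ` I)"
    using connected_continuous_image[OF assms(2)] assms(1) by (simp only: is_interval_connected_1)
  have "0 \<notin> f ` I" using assms(3) by auto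
  then have "\<not> (f a < 0 \<and> f b > 0)" if "a \<in> I" "b \<in> I" for a b
    using mem_is_interval_1_I[OF i, of "f a" "f b" 0] that by auto
  from this[OF assms(4,5)] this[OF assms(5,4)] show ?thesis
    using assms(3)[OF assms(4)] assms(3)[OF assms(5)] by (auto simp: sgn_if)
qed

locale frenet_curve = psr3_curve +
  assumes connected: "connected_space (points M)"
    and interval: "is_interval I" and nonempty: "I \<noteq> {}"
    and arc_length: "arc_length_parametrized M I \<alpha>"
    and nondegenerate: "nondegenerate_curve M D I \<alpha>"
    and acceleration_non_null:
      "t \<in> I \<Longrightarrow> metric M (\<alpha> t) (acceleration M D \<alpha> t) (acceleration M D \<alpha> t) \<noteq> 0"
begin

abbreviation g :: "real \<Rightarrow> 'a tvec \<Rightarrow> 'a tvec \<Rightarrow> real" where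
  "g t \<equiv> metric M (\<alpha> t)"

abbreviation T :: "real \<Rightarrow> 'a tvec" where "T \<equiv> velocity M \<alpha>"
abbreviation A :: "real \<Rightarrow> 'a tvec" where "A \<equiv> acceleration M D \<alpha>"
abbreviation N :: "real \<Rightarrow> 'a tvec" where "N \<equiv> principal_normal M D I \<alpha>"
abbreviation B :: "real \<Rightarrow> 'a tvec" where "B \<equiv> binormal M D I \<alpha>"
abbreviation \<epsilon>\<^sub>1 :: real where "\<epsilon>\<^sub>1 \<equiv> frenet_eps1 M I \<alpha>"
abbreviation \<epsilon>\<^sub>2 :: real where "\<epsilon>\<^sub>2 \<equiv> frenet_eps2 M D I \<alpha>"
abbreviation \<epsilon>\<^sub>3 :: real where "\<epsilon>\<^sub>3 \<equiv> frenet_eps3 M D I \<alpha>"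
abbreviation \<kappa> :: "real \<Rightarrow> real" where "\<kappa> \<equiv> curvature M D I \<alpha>"
abbreviation \<tau> :: "real \<Rightarrow> real" where "\<tau> \<equiv> torsion M D I \<alpha>"

section \<open>Signs, curvature and principal normal\<close>

lemma field_metric:
  assumes "t \<in> I" "field_along X" "field_along Y" "field_along Z"
  shows "g t (X t +\<^sub>t Y t) (Z t) = g t (X t) (Z t) + g t (Y t) (Z t)"
    "g t (Z t) (X t +\<^sub>t Y t) = g t (Z t) (X t) + g t (Z t) (Y t)"
    "g t (a *\<^sub>t X t) (Z t) = a * g t (X t) (Z t)"
    "g t (Z t) (a *\<^sub>t X t) = a * g t (Z t) (X t)"
proof -
  obtain c where "c \<in> charts_at M (\<alpha> t)" by (rule curve_chart[OF assms(1)])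
  then show "g t (X t +\<^sub>t Y t) (Z t) = g t (X t) (Z t) + g t (Y t) (Z t)"
    "g t (Z t) (X t +\<^sub>t Y t) = g t (Z t) (X t) + g t (Z t) (Y t)"
    "g t (a *\<^sub>t X t) (Z t) = a * g t (X t) (Z t)"
    "g t (Z t) (a *\<^sub>t X t) = a * g t (Z t) (X t)"
    using assms by (simp_all add: metric_add metric_scale field_tangent)
qed

lemma field_metric_symmetric:
  "t \<in> I \<Longrightarrow> field_along X \<Longrightarrow> field_along Y \<Longrightarrow> g t (X t) (Y t) = g t (Y t) (X t)"
  by (simp add: metric_symmetric curve_point field_tangent)

text \<open>Applied to pairs of frame vectors, this is the source of the skew symmetry of the Frenet
  equations.\<close>

lemma metric_constant:
  assumes "field_along X" "field_along Y" "\<And>s. s \<in> I \<Longrightarrow> g s (X s) (Y s) = k" "t \<in> I"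
  shows "g t (covd M D \<alpha> X t) (Y t) + g t (X t) (covd M D \<alpha> Y t) = 0"
proof -
  have "((\<lambda>s. g s (X s) (Y s)) has_real_derivative 0) (at t)"
    by (rule has_field_derivative_transform_within_open[OF DERIV_const[of k] open_I assms(4)])
       (simp add: assms(3))
  then show ?thesis
    using metric_has_derivative[OF assms(1,2,4)] DERIV_unique by blast
qed

lemma
  shows gTT: "t \<in> I \<Longrightarrow> g t (T t) (T t) = \<epsilon>\<^sub>1"
    and eps1: "\<epsilon>\<^sub>1 = 1 \<or> \<epsilon>\<^sub>1 = -1"
proof -
  obtain e where e: "e \<in> {1, -1}" "\<forall>t\<in>I. g t (T t) (T t) = e"
    using arc_length by (auto simp: arc_length_parametrized_def)
  have "\<epsilon>\<^sub>1 = e"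
    \<comment> \<open>Uniqueness needs a point of \<open>I\<close>: on an empty interval every
      number would satisfy the description.\<close>
    unfolding frenet_eps1_def by (rule the_equality) (use e nonempty in auto)
  then show "t \<in> I \<Longrightarrow> g t (T t) (T t) = \<epsilon>\<^sub>1" "\<epsilon>\<^sub>1 = 1 \<or> \<epsilon>\<^sub>1 = -1"
    using e by auto
qed

lemma field_acceleration: "field_along A"
  unfolding acceleration_def by (intro field_covd field_velocity)

lemma gTA:
  assumes "t \<in> I"
  shows "g t (T t) (A t) = 0"
  using metric_constant[OF field_velocity field_velocity gTT assms]
    field_metric_symmetric[OF assms field_velocity field_acceleration]
  by (simp add: acceleration_def)

lemma
  shows gAA: "t \<in> I \<Longrightarrow> g t (A t) (A t) = \<epsilon>\<^sub>2 * \<bar>g t (A t) (A t)\<bar>"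
    and eps2: "\<epsilon>\<^sub>2 = 1 \<or> \<epsilon>\<^sub>2 = -1"
proof -
  have c: "sgn (g s (A s) (A s)) = sgn (g t (A t) (A t))" if "s \<in> I" "t \<in> I" for s t
    by (rule continuous_nonzero_sgn_constant[OF interval smooth_on_imp_continuous_on[OF
          smooth_metric[OF field_acceleration field_acceleration]] acceleration_non_null that])
  obtain t0 where t0: "t0 \<in> I" using nonempty by blast
  have e: "\<epsilon>\<^sub>2 = sgn (g t0 (A t0) (A t0))"
    unfolding frenet_eps2_def
  proof (rule the_equality)
    show "\<forall>t\<in>I. sgn (g t (A t) (A t)) = sgn (g t0 (A t0) (A t0))" using c t0 by blast
    fix \<epsilon> assume "\<forall>t\<in>I. sgn (g t (A t) (A t)) = \<epsilon>"
    from bspec[OF this t0] show "\<epsilon> = sgn (g t0 (A t0) (A t0))" ..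
  qed
  then show "t \<in> I \<Longrightarrow> g t (A t) (A t) = \<epsilon>\<^sub>2 * \<bar>g t (A t) (A t)\<bar>"
    using c[of t t0] t0 by (metis sgn_mult_abs)
  show "\<epsilon>\<^sub>2 = 1 \<or> \<epsilon>\<^sub>2 = -1"
    using e acceleration_non_null[OF t0] by (simp add: sgn_if)
qed

text \<open>Curvature comes first, since the description of \<open>N\<close> refers to it. Taking
  the norm of \<open>A\<close> forces the square of any candidate \<open>k'\<close> to be the
  absolute value of \<open>g t (A t) (A t)\<close>; then \<open>N\<close> is the only vector whose
  prescribed multiple is \<open>A\<close>.\<close>

lemma
  assumes t: "t \<in> I"
  shows curvature_eq: "\<kappa> t = sqrt \<bar>g t (A t) (A t)\<bar>"
    and curvature_pos: "\<kappa> t > 0"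
    and principal_normal_eq: "N t = (\<epsilon>\<^sub>2 * inverse (\<kappa> t)) *\<^sub>t A t"
    and acceleration_eq: "A t = (\<epsilon>\<^sub>2 * \<kappa> t) *\<^sub>t N t"
proof -
  obtain c where c: "c \<in> charts_at M (\<alpha> t)" by (rule curve_chart[OF t])
  have At: "A t \<in> tangent_space M (\<alpha> t)" by (rule field_tangent[OF field_acceleration t])
  define k where "k = sqrt \<bar>g t (A t) (A t)\<bar>"
  have k: "k > 0" "k * k = \<bar>g t (A t) (A t)\<bar>"
    using acceleration_non_null[OF t] by (simp_all add: k_def)
  have e: "\<epsilon>\<^sub>2 * \<epsilon>\<^sub>2 = 1" using eps2 by auto
  define n where "n = (\<epsilon>\<^sub>2 * inverse k) *\<^sub>t A t"
  have n: "n \<in> tangent_space M (\<alpha> t)" by (simp add: n_def tscale_tangent At)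
  have "g t n n = \<epsilon>\<^sub>2 * \<epsilon>\<^sub>2 * (inverse k * inverse k) * g t (A t) (A t)"
    using At by (simp add: n_def metric_scale[OF c] tscale_tangent)
  also have "\<dots> = \<epsilon>\<^sub>2 * (inverse k * inverse k * \<bar>g t (A t) (A t)\<bar>)"
    using e gAA[OF t] by simp
  also have "inverse k * inverse k * \<bar>g t (A t) (A t)\<bar> = 1"
    using k(1) by (simp add: field_simps flip: k(2))
  finally have nn: "g t n n = \<epsilon>\<^sub>2" by simp
  have An: "A t = (\<epsilon>\<^sub>2 * k) *\<^sub>t n"
  proof -
    have "(\<epsilon>\<^sub>2 * k) * (\<epsilon>\<^sub>2 * inverse k) = 1"
      using k(1) eps2 by auto
    then show ?thesis by (simp add: n_def tscale_def)
  qed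
  show \<kappa>: "\<kappa> t = sqrt \<bar>g t (A t) (A t)\<bar>"
    unfolding curvature_def
  proof (rule the_equality)
    show "sqrt \<bar>g t (A t) (A t)\<bar> > 0 \<and> (\<exists>n\<in>tangent_space M (\<alpha> t). g t n n = \<epsilon>\<^sub>2 \<and>
        A t = (\<epsilon>\<^sub>2 * sqrt \<bar>g t (A t) (A t)\<bar>) *\<^sub>t n)"
      using k(1) n nn An unfolding k_def by blast
  next
    fix k' assume "k' > 0 \<and> (\<exists>n\<in>tangent_space M (\<alpha> t). g t n n = \<epsilon>\<^sub>2 \<and> A t = (\<epsilon>\<^sub>2 * k') *\<^sub>t n)"
    then obtain n' where n': "n' \<in> tangent_space M (\<alpha> t)" "g t n' n' = \<epsilon>\<^sub>2"
        "A t = (\<epsilon>\<^sub>2 * k') *\<^sub>t n'" and k': "k' > 0" by blast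
    then have "g t (A t) (A t) = k' * k' * \<epsilon>\<^sub>2"
      using e by (simp add: metric_scale[OF c] tscale_tangent)
    then have "\<bar>g t (A t) (A t)\<bar> = k'\<^sup>2"
      using eps2 by (auto simp: abs_mult power2_eq_square)
    then show "k' = sqrt \<bar>g t (A t) (A t)\<bar>" using k' by simp
  qed
  then show "\<kappa> t > 0" using k by (simp add: k_def)
  have \<kappa>k: "\<kappa> t = k" using \<kappa> by (simp add: k_def)
  have "N t = n"
    unfolding principal_normal_def \<kappa>k
  proof (rule the_equality)
    show "n \<in> tangent_space M (\<alpha> t) \<and> g t n n = \<epsilon>\<^sub>2 \<and> A t = (\<epsilon>\<^sub>2 * k) *\<^sub>t n"
      using n nn An by blast
    fix n' assume "n' \<in> tangent_space M (\<alpha> t) \<and> g t n' n' = \<epsilon>\<^sub>2 \<and> A t = (\<epsilon>\<^sub>2 * k) *\<^sub>t n'"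
    then have "(\<epsilon>\<^sub>2 * k) *\<^sub>t n' = (\<epsilon>\<^sub>2 * k) *\<^sub>t n" using An by metis
    moreover have "\<epsilon>\<^sub>2 * k \<noteq> 0" using k eps2 by auto
    ultimately show "n' = n" by (simp add: tscale_def fun_eq_iff)
  qed
  then show "N t = (\<epsilon>\<^sub>2 * inverse (\<kappa> t)) *\<^sub>t A t" "A t = (\<epsilon>\<^sub>2 * \<kappa> t) *\<^sub>t N t"
    by (simp_all only: \<kappa>k n_def[symmetric] An[symmetric])
qed

lemma smooth_curvature: "smooth_on \<kappa> I"
proof -
  have "smooth_on (\<lambda>t. \<bar>g t (A t) (A t)\<bar> powr (1/2)) I"
    by (intro smooth_on_abs_powr open_I smooth_metric field_acceleration acceleration_non_null)
  then show ?thesis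
    by (rule smooth_on_cong[OF open_I, rotated]) (simp add: curvature_eq powr_half_sqrt)
qed

lemma field_normal: "field_along N"
proof -
  have "field_along (\<lambda>t. (\<epsilon>\<^sub>2 * inverse (\<kappa> t)) *\<^sub>t A t)"
    using curvature_pos
    by (intro field_scale field_acceleration smooth_on_mult smooth_on_const smooth_on_inverse
        smooth_curvature open_I) force
  then show ?thesis
    by (rule field_cong) (simp add: principal_normal_eq)
qed

lemma gTN:
  assumes "t \<in> I"
  shows "g t (T t) (N t) = 0"
  using field_metric(4)[OF assms field_acceleration field_velocity field_velocity] gTA[OF assms]
  by (simp add: principal_normal_eq assms)

lemma gNN:
  assumes t: "t \<in> I"
  shows "g t (N t) (N t) = \<epsilon>\<^sub>2"
proof -
  note F = field_acceleration field_normal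
  have "g t (A t) (A t) = \<epsilon>\<^sub>2 * (\<kappa> t)\<^sup>2"
    using gAA[OF t] curvature_eq[OF t] by simp
  moreover have "g t (A t) (A t) = (\<epsilon>\<^sub>2 * \<epsilon>\<^sub>2) * (\<kappa> t)\<^sup>2 * g t (N t) (N t)"
    unfolding acceleration_eq[OF t]
    using field_metric(3)[OF t F(2) F(2) field_scale[OF smooth_on_const F(2)]]
      field_metric(4)[OF t F(2) F(2) F(2)]
    by (simp add: power2_eq_square)
  ultimately show ?thesis
    using curvature_pos[OF t] eps2 by auto
qed

section \<open>The binormal and the orthonormal frame\<close>

lemma metric_sign_cases: "metric_sign M = 1 \<or> metric_sign M = -1"
proof -
  obtain t where "t \<in> I" using nonempty by blast
  then obtain c where "c \<in> charts_at M (\<alpha> t)" by (rule curve_chart)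
  then show ?thesis
    using metric_sign_eq[OF connected] det_gram_nonzero by (simp add: sgn_if)
qed

lemma eps3: "\<epsilon>\<^sub>3 = 1 \<or> \<epsilon>\<^sub>3 = -1"
  using metric_sign_cases eps1 eps2 by (auto simp: frenet_eps3_def)

lemma eps_square: "\<epsilon>\<^sub>1 * \<epsilon>\<^sub>1 = 1" "\<epsilon>\<^sub>2 * \<epsilon>\<^sub>2 = 1" "\<epsilon>\<^sub>3 * \<epsilon>\<^sub>3 = 1"
  using eps1 eps2 eps3 by auto

lemma field_TxN: "field_along (\<lambda>t. cross M (\<alpha> t) (T t) (N t))"
  by (intro field_cross field_velocity field_normal)

lemma field_binormal: "field_along B"
  using field_scale[OF smooth_on_const field_TxN, of "\<epsilon>\<^sub>3"] by (simp add: binormal_def[abs_def])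

text \<open>The defining property of the cross product, through which scalar products with
  \<open>B\<close> become volumes. It yields orthogonality and later the torsion term of
  \<open>equiaffine_volume_eq\<close>.\<close>

lemma gB:
  assumes t: "t \<in> I" and X: "field_along X"
  shows "g t (B t) (X t) = \<epsilon>\<^sub>3 * volume M (\<alpha> t) (T t) (N t) (X t)"
proof -
  obtain c where c: "c \<in> charts_at M (\<alpha> t)" by (rule curve_chart[OF t])
  show ?thesis
    using field_metric(3)[OF t field_TxN X X, of "\<epsilon>\<^sub>3"] metric_cross[OF _ _ c]
      field_tangent[OF field_velocity t] field_tangent[OF field_normal t] field_tangent[OF X t]
    by (simp add: binormal_def)
qed

lemma
  assumes t: "t \<in> I"
  shows gTB: "g t (T t) (B t) = 0" and gNB: "g t (N t) (B t) = 0"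
    and gBB: "g t (B t) (B t) = \<epsilon>\<^sub>3"
    and volume_TNB: "volume M (\<alpha> t) (T t) (N t) (B t) = 1"
proof -
  obtain c where c: "c \<in> charts_at M (\<alpha> t)" by (rule curve_chart[OF t])
  note F = field_tangent[OF field_velocity t] field_tangent[OF field_normal t]
  show "g t (T t) (B t) = 0" "g t (N t) (B t) = 0"
    using gB[OF t field_velocity] gB[OF t field_normal] volume_same[OF F c]
      field_metric_symmetric[OF t field_binormal field_velocity]
      field_metric_symmetric[OF t field_binormal field_normal]
    by simp_all
  have "g t (B t) (B t) = \<epsilon>\<^sub>3 * \<epsilon>\<^sub>3 * g t (cross M (\<alpha> t) (T t) (N t)) (cross M (\<alpha> t) (T t) (N t))"
    using field_metric(3)[OF t field_TxN field_TxN field_binormal, of "\<epsilon>\<^sub>3"]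
      field_metric(4)[OF t field_TxN field_TxN field_TxN, of "\<epsilon>\<^sub>3"]
    by (simp add: binormal_def)
  also have "\<dots> = metric_sign M * \<epsilon>\<^sub>1 * \<epsilon>\<^sub>2"
    using metric_cross_cross[OF F c] metric_sign_eq[OF connected c]
    by (simp add: gTT[OF t] gNN[OF t] gTN[OF t] eps_square)
  finally show BB: "g t (B t) (B t) = \<epsilon>\<^sub>3"
    by (simp add: frenet_eps3_def)
  then show "volume M (\<alpha> t) (T t) (N t) (B t) = 1"
    using gB[OF t field_binormal] eps3 by auto
qed

lemma frenet_frame_eqI:
  assumes t: "t \<in> I" and "field_along X" "field_along Y"
    and "g t (T t) (X t) = g t (T t) (Y t)" "g t (N t) (X t) = g t (N t) (Y t)"
      "g t (B t) (X t) = g t (B t) (Y t)"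
  shows "X t = Y t"
proof -
  obtain c where c: "c \<in> charts_at M (\<alpha> t)" by (rule curve_chart[OF t])
  show ?thesis
    by (rule frame_eqI[OF c, of "T t" "N t" "B t"])
       (use assms volume_TNB[OF t] in \<open>auto intro: field_tangent field_velocity field_normal field_binormal\<close>)
qed

lemma gDN:
  assumes t: "t \<in> I"
  shows "g t (T t) (covd M D \<alpha> N t) = - \<kappa> t" "g t (N t) (covd M D \<alpha> N t) = 0"
proof -
  note F = field_velocity field_normal field_covd[OF field_normal]
  have "g t (A t) (N t) = \<kappa> t"
    unfolding acceleration_eq[OF t]
    using field_metric(3)[OF t F(2) F(2) F(2)] gNN[OF t] eps_square by simp
  then show "g t (T t) (covd M D \<alpha> N t) = - \<kappa> t"
    using metric_constant[OF F(1,2) gTN t] by (simp add: acceleration_def)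
  show "g t (N t) (covd M D \<alpha> N t) = 0"
    using metric_constant[OF F(2,2) gNN t] field_metric_symmetric[OF t F(2,3)] by simp
qed

lemma metric_TNB:
  assumes t: "t \<in> I"
  shows "g t (T t) (p *\<^sub>t T t +\<^sub>t q *\<^sub>t N t +\<^sub>t r *\<^sub>t B t) = \<epsilon>\<^sub>1 * p"
    "g t (N t) (p *\<^sub>t T t +\<^sub>t q *\<^sub>t N t +\<^sub>t r *\<^sub>t B t) = \<epsilon>\<^sub>2 * q"
    "g t (B t) (p *\<^sub>t T t +\<^sub>t q *\<^sub>t N t +\<^sub>t r *\<^sub>t B t) = \<epsilon>\<^sub>3 * r"
proof -
  obtain c where c: "c \<in> charts_at M (\<alpha> t)" by (rule curve_chart[OF t])
  have F: "T t \<in> tangent_space M (\<alpha> t)" "N t \<in> tangent_space M (\<alpha> t)" "B t \<in> tangent_space M (\<alpha> t)"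
    using t by (auto intro: field_tangent field_velocity field_normal field_binormal)
  have s: "g t (N t) (T t) = 0" "g t (B t) (T t) = 0" "g t (B t) (N t) = 0"
    using gTN[OF t] gTB[OF t] gNB[OF t] F metric_symmetric[OF curve_point[OF t]] by metis+
  show "g t (T t) (p *\<^sub>t T t +\<^sub>t q *\<^sub>t N t +\<^sub>t r *\<^sub>t B t) = \<epsilon>\<^sub>1 * p"
    "g t (N t) (p *\<^sub>t T t +\<^sub>t q *\<^sub>t N t +\<^sub>t r *\<^sub>t B t) = \<epsilon>\<^sub>2 * q"
    "g t (B t) (p *\<^sub>t T t +\<^sub>t q *\<^sub>t N t +\<^sub>t r *\<^sub>t B t) = \<epsilon>\<^sub>3 * r"
    using F
    by (simp_all add: metric_add[OF c] metric_scale[OF c] tadd_tangent tscale_tangent s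
        gTT[OF t] gNN[OF t] gBB[OF t] gTN[OF t] gTB[OF t] gNB[OF t])
qed

lemma field_TNB:
  assumes "smooth_on p I" "smooth_on q I" "smooth_on r I"
  shows "field_along (\<lambda>t. p t *\<^sub>t T t +\<^sub>t q t *\<^sub>t N t +\<^sub>t r t *\<^sub>t B t)"
  by (intro field_add field_scale assms field_velocity field_normal field_binormal)

lemma frame_expansion:
  assumes t: "t \<in> I" and X: "field_along X"
  shows "X t = (\<epsilon>\<^sub>1 * g t (T t) (X t)) *\<^sub>t T t +\<^sub>t (\<epsilon>\<^sub>2 * g t (N t) (X t)) *\<^sub>t N t +\<^sub>t
    (\<epsilon>\<^sub>3 * g t (B t) (X t)) *\<^sub>t B t"
proof -
  \<comment> \<open>The coefficients are frozen at \<open>t\<close>: uniqueness is stated for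
    fields, and constant coefficients make this one without any smoothness argument.\<close>
  let ?Y = "\<lambda>s. (\<epsilon>\<^sub>1 * g t (T t) (X t)) *\<^sub>t T s +\<^sub>t (\<epsilon>\<^sub>2 * g t (N t) (X t)) *\<^sub>t N s +\<^sub>t
    (\<epsilon>\<^sub>3 * g t (B t) (X t)) *\<^sub>t B s"
  have Y: "field_along ?Y" by (intro field_TNB smooth_on_const)
  show ?thesis
    by (rule frenet_frame_eqI[OF t X Y])
       (simp_all only: metric_TNB[OF t] mult.assoc[symmetric] eps_square mult_1_left)
qed

section \<open>Torsion and the Frenet equations\<close>

lemma
  assumes t: "t \<in> I"
  shows torsion_eq: "\<tau> t = g t (B t) (covd M D \<alpha> N t)"
    and covd_normal: "covd M D \<alpha> N t = (- \<epsilon>\<^sub>1 * \<kappa> t) *\<^sub>t T t +\<^sub>t (\<epsilon>\<^sub>3 * \<tau> t) *\<^sub>t B t"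
proof -
  let ?r = "g t (B t) (covd M D \<alpha> N t)"
  have z: "u +\<^sub>t 0 *\<^sub>t v +\<^sub>t w = u +\<^sub>t w" for u v w :: "'a tvec"
    by (simp add: fun_eq_iff)
  \<comment> \<open>The constant norm of \<open>N\<close> removes the middle component, and
    orthogonality to \<open>T\<close> fixes the first; the coefficient of \<open>B\<close> is all
    that remains to be named torsion.\<close>
  have DN: "covd M D \<alpha> N t = (- \<epsilon>\<^sub>1 * \<kappa> t) *\<^sub>t T t +\<^sub>t (\<epsilon>\<^sub>3 * ?r) *\<^sub>t B t"
    using frame_expansion[OF t field_covd[OF field_normal]] gDN[OF t] by (simp add: z)
  show *: "\<tau> t = ?r"
    unfolding torsion_def
  proof (rule the_equality, rule DN)
    fix r assume "covd M D \<alpha> N t = (- \<epsilon>\<^sub>1 * \<kappa> t) *\<^sub>t T t +\<^sub>t (\<epsilon>\<^sub>3 * r) *\<^sub>t B t"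
    then have "?r = g t (B t) ((- \<epsilon>\<^sub>1 * \<kappa> t) *\<^sub>t T t +\<^sub>t 0 *\<^sub>t N t +\<^sub>t (\<epsilon>\<^sub>3 * r) *\<^sub>t B t)"
      by (simp only: z)
    then show "r = ?r"
      using eps_square by (simp add: metric_TNB[OF t] flip: mult.assoc)
  qed
  show "covd M D \<alpha> N t = (- \<epsilon>\<^sub>1 * \<kappa> t) *\<^sub>t T t +\<^sub>t (\<epsilon>\<^sub>3 * \<tau> t) *\<^sub>t B t"
    unfolding * by (rule DN)
qed

lemma smooth_torsion: "smooth_on \<tau> I"
  by (rule smooth_on_cong[OF open_I _ smooth_metric[OF field_binormal field_covd[OF field_normal]]])
     (simp add: torsion_eq)

text \<open>By differentiating the constant products with \<open>T\<close>, \<open>N\<close> and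
  \<open>B\<close>, the components are the negatives of those already known, so only the
  \<open>N\<close> component survives.\<close>

lemma covd_binormal:
  assumes t: "t \<in> I"
  shows "covd M D \<alpha> B t = (- \<epsilon>\<^sub>2 * \<tau> t) *\<^sub>t N t"
proof -
  note F = field_velocity field_normal field_binormal
  note DB = field_covd[OF field_binormal]
  have "g t (A t) (B t) = 0"
    unfolding acceleration_eq[OF t]
    using field_metric(3)[OF t F(2) F(2) F(3)] gNB[OF t] by simp
  then have 1: "g t (T t) (covd M D \<alpha> B t) = 0"
    using metric_constant[OF F(1,3) gTB t] by (simp add: acceleration_def)
  have 2: "g t (N t) (covd M D \<alpha> B t) = - \<tau> t"
    using metric_constant[OF F(2,3) gNB t] field_metric_symmetric[OF t F(3) field_covd[OF F(2)]]
    by (simp add: torsion_eq[OF t])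
  have 3: "g t (B t) (covd M D \<alpha> B t) = 0"
    using metric_constant[OF F(3,3) gBB t] field_metric_symmetric[OF t F(3) DB] by simp
  show ?thesis
    using frame_expansion[OF t DB] by (simp add: 1 2 3 fun_eq_iff)
qed

lemma covd_TNB:
  assumes t: "t \<in> I" and "smooth_on p I" "smooth_on q I" "smooth_on r I"
    and "(p has_real_derivative p') (at t)" "(q has_real_derivative q') (at t)"
      "(r has_real_derivative r') (at t)"
  shows "covd M D \<alpha> (\<lambda>t. p t *\<^sub>t T t +\<^sub>t q t *\<^sub>t N t +\<^sub>t r t *\<^sub>t B t) t =
    (p' - \<epsilon>\<^sub>1 * \<kappa> t * q t) *\<^sub>t T t +\<^sub>t (\<epsilon>\<^sub>2 * \<kappa> t * p t + q' - \<epsilon>\<^sub>2 * \<tau> t * r t) *\<^sub>t N t +\<^sub>t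
    (r' + \<epsilon>\<^sub>3 * \<tau> t * q t) *\<^sub>t B t"
proof -
  note F = field_velocity field_normal field_binormal
  have DT: "covd M D \<alpha> T t = (\<epsilon>\<^sub>2 * \<kappa> t) *\<^sub>t N t"
    using acceleration_eq[OF t] by (simp add: acceleration_def)
  show ?thesis
    using assms F t
    by (simp add: covd_add field_add field_scale covd_scale[OF assms(5)] covd_scale[OF assms(6)]
        covd_scale[OF assms(7)] DT covd_normal covd_binormal)
       (simp add: fun_eq_iff algebra_simps)
qed

text \<open>\<open>A\<close> is a multiple of \<open>N\<close>, so the part of its derivative along
  \<open>N\<close> adds no volume. What is left is the volume of \<open>T\<close>, \<open>N\<close>
  and the derivative of \<open>N\<close>, which \<open>gB\<close> identifies with the torsion up to
  sign.\<close>

lemma equiaffine_volume_eq: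
  assumes t: "t \<in> I"
  shows "equiaffine_volume M D \<alpha> t = \<epsilon>\<^sub>3 * (\<kappa> t)\<^sup>2 * \<tau> t"
proof -
  obtain c where c: "c \<in> charts_at M (\<alpha> t)" by (rule curve_chart[OF t])
  note F = field_velocity field_normal field_covd[OF field_normal]
  have s: "smooth_on (\<lambda>t. \<epsilon>\<^sub>2 * \<kappa> t) I"
    by (intro smooth_on_mult smooth_on_const smooth_curvature open_I)
  have "covd M D \<alpha> A t = covd M D \<alpha> (\<lambda>t. (\<epsilon>\<^sub>2 * \<kappa> t) *\<^sub>t N t) t"
    by (rule covd_cong[OF field_acceleration _ t]) (rule acceleration_eq)
  also have "\<dots> = deriv (\<lambda>t. \<epsilon>\<^sub>2 * \<kappa> t) t *\<^sub>t N t +\<^sub>t (\<epsilon>\<^sub>2 * \<kappa> t) *\<^sub>t covd M D \<alpha> N t"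
    by (rule covd_scale[OF smooth_on_imp_DERIV[OF s t] F(2) t])
  finally have "equiaffine_volume M D \<alpha> t =
      (\<epsilon>\<^sub>2 * \<kappa> t) * (\<epsilon>\<^sub>2 * \<kappa> t) * volume M (\<alpha> t) (T t) (N t) (covd M D \<alpha> N t)"
    using volume_scale_combination[OF c F[THEN field_tangent, OF t]]
    by (simp add: equiaffine_volume_def acceleration_eq[OF t])
  moreover have "\<tau> t = \<epsilon>\<^sub>3 * volume M (\<alpha> t) (T t) (N t) (covd M D \<alpha> N t)"
    using gB[OF t F(3)] torsion_eq[OF t] by simp
  ultimately show ?thesis
    using eps2 eps3 by (auto simp: power2_eq_square)
qed

lemma torsion_nonzero: "t \<in> I \<Longrightarrow> \<tau> t \<noteq> 0"
  using nondegenerate by (auto simp: nondegenerate_curve_def equiaffine_volume_eq)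

end

section \<open>The Cartan frame\<close>

context frenet_curve
begin

abbreviation \<kappa>' :: "real \<Rightarrow> real" where "\<kappa>' \<equiv> deriv \<kappa>"
abbreviation \<kappa>'' :: "real \<Rightarrow> real" where "\<kappa>'' \<equiv> deriv \<kappa>'"
abbreviation \<kappa>''' :: "real \<Rightarrow> real" where "\<kappa>''' \<equiv> deriv \<kappa>''"
abbreviation \<tau>' :: "real \<Rightarrow> real" where "\<tau>' \<equiv> deriv \<tau>"
abbreviation \<tau>'' :: "real \<Rightarrow> real" where "\<tau>'' \<equiv> deriv \<tau>'"
abbreviation \<tau>''' :: "real \<Rightarrow> real" where "\<tau>''' \<equiv> deriv \<tau>''"

definition \<phi> :: "real \<Rightarrow> real" where
  "\<phi> t = \<kappa> t powr (-1/3) * \<bar>\<tau> t\<bar> powr (-1/6)"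

definition \<rho> :: "real \<Rightarrow> real" where
  "\<rho> t = - (\<kappa>' t / \<kappa> t) / 3 - (\<tau>' t / \<tau> t) / 6"

text \<open>The derivatives of \<open>\<rho>\<close> are given as explicit formulas in ratios of
  derivatives to \<open>\<kappa>\<close> or \<open>\<tau>\<close>, and shown to be derivatives
  later; \<open>cartan_coefficients\<close> substitutes these formulas.\<close>

definition \<rho>' :: "real \<Rightarrow> real" where
  "\<rho>' t = - (\<kappa>'' t / \<kappa> t - (\<kappa>' t / \<kappa> t)\<^sup>2) / 3 - (\<tau>'' t / \<tau> t - (\<tau>' t / \<tau> t)\<^sup>2) / 6"

definition \<rho>'' :: "real \<Rightarrow> real" where
  "\<rho>'' t = - (\<kappa>''' t / \<kappa> t - 3 * \<kappa>' t * \<kappa>'' t / (\<kappa> t)\<^sup>2 + 2 * (\<kappa>' t / \<kappa> t) ^ 3) / 3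
    - (\<tau>''' t / \<tau> t - 3 * \<tau>' t * \<tau>'' t / (\<tau> t)\<^sup>2 + 2 * (\<tau>' t / \<tau> t) ^ 3) / 6"

lemma phi_pos: "t \<in> I \<Longrightarrow> \<phi> t > 0"
  using curvature_pos[of t] torsion_nonzero[of t] by (auto simp: \<phi>_def)

lemma equiaffine_speed_eq:
  assumes "t \<in> I"
  shows "equiaffine_speed M D \<alpha> t = \<phi> t"
proof -
  have "\<bar>\<epsilon>\<^sub>3 * (\<kappa> t)\<^sup>2 * \<tau> t\<bar> = (\<kappa> t) powr 2 * \<bar>\<tau> t\<bar>"
    using eps3 curvature_pos[OF assms] by (auto simp: abs_mult)
  then show ?thesis
    by (simp add: equiaffine_speed_def equiaffine_volume_eq[OF assms] \<phi>_def powr_mult powr_powr)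
qed

text \<open>Exactly the powers in the result: the second Cartan vector and second curvature carry
  the square, the third vector and first curvature the cube.\<close>

lemma phi_powers:
  assumes "t \<in> I"
  shows "\<phi> t ^ 2 = \<kappa> t powr (-2/3) * \<bar>\<tau> t\<bar> powr (-1/3)"
    and "\<phi> t ^ 3 = inverse (\<kappa> t) * \<bar>\<tau> t\<bar> powr (-1/2)"
proof -
  have \<kappa>: "\<kappa> t > 0" by (rule curvature_pos[OF assms])
  have \<tau>: "\<tau> t \<noteq> 0" by (rule torsion_nonzero[OF assms])
  have p: "(x powr a) ^ n = x powr (a * real n)" if "x \<noteq> 0" for x a :: real and n
    using that by (induction n) (simp_all add: algebra_simps powr_add)
  show "\<phi> t ^ 2 = \<kappa> t powr (-2/3) * \<bar>\<tau> t\<bar> powr (-1/3)"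
    using \<kappa> \<tau> by (simp add: \<phi>_def power_mult_distrib p)
  show "\<phi> t ^ 3 = inverse (\<kappa> t) * \<bar>\<tau> t\<bar> powr (-1/2)"
  proof -
    have "inverse (\<kappa> t) = \<kappa> t powr (-1)" using \<kappa> by (simp add: powr_minus)
    then show ?thesis using \<kappa> \<tau> by (simp only: \<phi>_def power_mult_distrib) (simp add: p)
  qed
qed

lemma smooth_derivatives:
  "smooth_on \<kappa>' I" "smooth_on \<kappa>'' I" "smooth_on \<kappa>''' I"
  "smooth_on \<tau>' I" "smooth_on \<tau>'' I" "smooth_on \<tau>''' I"
  by (intro smooth_on_deriv open_I smooth_curvature smooth_torsion)+

lemma derivatives:
  assumes "t \<in> I"
  shows "(\<kappa> has_real_derivative \<kappa>' t) (at t)" "(\<kappa>' has_real_derivative \<kappa>'' t) (at t)"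
    "(\<kappa>'' has_real_derivative \<kappa>''' t) (at t)"
    "(\<tau> has_real_derivative \<tau>' t) (at t)" "(\<tau>' has_real_derivative \<tau>'' t) (at t)"
    "(\<tau>'' has_real_derivative \<tau>''' t) (at t)"
  using assms by (auto intro: smooth_on_imp_DERIV smooth_curvature smooth_torsion smooth_derivatives)

lemma smooth_phi: "smooth_on \<phi> I"
  unfolding \<phi>_def
  by (intro smooth_on_mult smooth_on_powr smooth_on_abs_powr open_I smooth_curvature smooth_torsion
      curvature_pos torsion_nonzero)

lemma smooth_log_derivative:
  assumes "smooth_on f I" "\<And>t. t \<in> I \<Longrightarrow> f t \<noteq> 0"
  shows "smooth_on (\<lambda>t. deriv f t / f t) I"
  unfolding divide_inverse
  by (intro smooth_on_mult smooth_on_inverse smooth_on_deriv open_I assms)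

lemma smooth_rho: "smooth_on \<rho> I"
proof -
  have "smooth_on (\<lambda>t. (-1/3) * (\<kappa>' t / \<kappa> t) + (-1/6) * (\<tau>' t / \<tau> t)) I"
    using curvature_pos torsion_nonzero
    by (intro smooth_on_add smooth_on_mult smooth_on_const smooth_log_derivative open_I
        smooth_curvature smooth_torsion) force+
  then show ?thesis
    by (rule smooth_on_cong[OF open_I, rotated]) (simp add: \<rho>_def)
qed

lemma log_derivative_derivatives:
  fixes f :: "real \<Rightarrow> real"
  assumes "(f has_real_derivative f\<^sub>1 t) (at t)" "(f\<^sub>1 has_real_derivative f\<^sub>2 t) (at t)"
    "(f\<^sub>2 has_real_derivative f\<^sub>3 t) (at t)" "f t \<noteq> 0"
  shows "((\<lambda>s. f\<^sub>1 s / f s) has_real_derivative f\<^sub>2 t / f t - (f\<^sub>1 t / f t)\<^sup>2) (at t)"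
    and "((\<lambda>s. f\<^sub>2 s / f s - (f\<^sub>1 s / f s)\<^sup>2) has_real_derivative
      f\<^sub>3 t / f t - 3 * f\<^sub>1 t * f\<^sub>2 t / (f t)\<^sup>2 + 2 * (f\<^sub>1 t / f t) ^ 3) (at t)"
proof -
  have q: "((\<lambda>s. h s / f s) has_real_derivative h' / f t - h t * f\<^sub>1 t / (f t)\<^sup>2) (at t)"
    if "(h has_real_derivative h') (at t)" for h h'
    using DERIV_divide[OF that assms(1,4)] assms(4) by (simp add: field_simps power2_eq_square)
  show 1: "((\<lambda>s. f\<^sub>1 s / f s) has_real_derivative f\<^sub>2 t / f t - (f\<^sub>1 t / f t)\<^sup>2) (at t)"
    using q[OF assms(2)] by (simp add: power2_eq_square)
  show "((\<lambda>s. f\<^sub>2 s / f s - (f\<^sub>1 s / f s)\<^sup>2) has_real_derivative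
      f\<^sub>3 t / f t - 3 * f\<^sub>1 t * f\<^sub>2 t / (f t)\<^sup>2 + 2 * (f\<^sub>1 t / f t) ^ 3) (at t)"
    by (rule DERIV_cong[OF DERIV_diff[OF q[OF assms(3)] DERIV_power[OF 1, of 2]]])
       (use assms(4) in \<open>simp add: field_simps power2_eq_square power3_eq_cube\<close>)
qed

lemma
  assumes t: "t \<in> I"
  shows rho_derivative: "(\<rho> has_real_derivative \<rho>' t) (at t)"
    and rho'_derivative: "(\<rho>' has_real_derivative \<rho>'' t) (at t)"
proof -
  have nz: "\<kappa> t \<noteq> 0" "\<tau> t \<noteq> 0"
    using curvature_pos[OF t] torsion_nonzero[OF t] by auto
  note l = log_derivative_derivatives[of \<kappa> \<kappa>' t \<kappa>'' \<kappa>''', OF derivatives(1-3)[OF t] nz(1)]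
    log_derivative_derivatives[of \<tau> \<tau>' t \<tau>'' \<tau>''', OF derivatives(4-6)[OF t] nz(2)]
  show "(\<rho> has_real_derivative \<rho>' t) (at t)"
    unfolding \<rho>_def[abs_def] \<rho>'_def
    by (intro DERIV_diff DERIV_cdivide DERIV_minus l)
  show "(\<rho>' has_real_derivative \<rho>'' t) (at t)"
    unfolding \<rho>'_def[abs_def] \<rho>''_def
    \<comment> \<open>The instantiation restricts the difference rule to the outer minus sign; the
      inner differences must stay whole to match \<open>l\<close>.\<close>
    by (intro DERIV_diff[where g = "\<lambda>s. (\<tau>'' s / \<tau> s - (\<tau>' s / \<tau> s)\<^sup>2) / 6"] DERIV_cdivide DERIV_minus l)
qed

lemma smooth_rho': "smooth_on \<rho>' I"
  by (rule smooth_on_cong[OF open_I _ smooth_on_deriv[OF open_I smooth_rho]])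
     (simp add: DERIV_imp_deriv rho_derivative)

lemma phi_derivative:
  assumes t: "t \<in> I"
  shows "(\<phi> has_real_derivative \<phi> t * \<rho> t) (at t)"
proof -
  have nz: "\<kappa> t > 0" "\<tau> t \<noteq> 0"
    using curvature_pos[OF t] torsion_nonzero[OF t] by auto
  \<comment> \<open>Passing to the square turns the factor with the absolute value into an ordinary
    power of a differentiable positive function.\<close>
  have abs_powr: "\<bar>x\<bar> powr (-1/6) = (x * x) powr (-1/12)" for x :: real
  proof (cases "x = 0")
    case False
    then have "x * x = \<bar>x\<bar> powr 2" by (simp add: power2_eq_square)
    then show ?thesis by (simp only: powr_powr) simp
  qed simp
  have pos: "\<tau> t * \<tau> t > 0" using nz by (simp flip: power2_eq_square)
  have "((\<lambda>s. \<kappa> s powr (-1/3)) has_real_derivative -1/3 * \<kappa> t powr (-1/3 - 1) * \<kappa>' t) (at t)"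
    by (rule DERIV_chain2[OF has_real_derivative_powr[OF nz(1)] derivatives(1)[OF t]])
  moreover have "((\<lambda>s. (\<tau> s * \<tau> s) powr (-1/12)) has_real_derivative
      -1/12 * (\<tau> t * \<tau> t) powr (-1/12 - 1) * (\<tau>' t * \<tau> t + \<tau>' t * \<tau> t)) (at t)"
    by (rule DERIV_chain2[OF has_real_derivative_powr[OF pos] DERIV_mult[OF derivatives(4,4)[OF t]]])
  ultimately have d: "(\<phi> has_real_derivative
      -1/3 * \<kappa> t powr (-1/3 - 1) * \<kappa>' t * (\<tau> t * \<tau> t) powr (-1/12) +
      -1/12 * (\<tau> t * \<tau> t) powr (-1/12 - 1) * (\<tau>' t * \<tau> t + \<tau>' t * \<tau> t) * \<kappa> t powr (-1/3)) (at t)"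
    unfolding \<phi>_def[abs_def] abs_powr by (rule DERIV_mult)
  have p: "\<kappa> t powr (-1/3 - 1) = \<kappa> t powr (-1/3) / \<kappa> t"
    "(\<tau> t * \<tau> t) powr (-1/12 - 1) = (\<tau> t * \<tau> t) powr (-1/12) / (\<tau> t * \<tau> t)"
    using nz pos by (simp_all only: powr_diff powr_one abs_of_pos less_imp_le)
  show ?thesis
    by (rule DERIV_cong[OF d], unfold p \<phi>_def abs_powr \<rho>_def) (use nz in \<open>simp add: field_simps\<close>)
qed

lemma phi_power_derivative:
  assumes t: "t \<in> I" and P: "(P has_real_derivative P') (at t)"
  shows "((\<lambda>s. \<phi> s ^ n * P s) has_real_derivative \<phi> t ^ n * (P' + n * \<rho> t * P t)) (at t)"
proof -
  have "((\<lambda>s. \<phi> s ^ n) has_real_derivative n * \<rho> t * \<phi> t ^ n) (at t)"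
  proof (induction n)
    case (Suc n)
    from DERIV_mult[OF phi_derivative[OF t] Suc] show ?case
      by (simp add: algebra_simps)
  qed simp
  from DERIV_mult[OF this P] show ?thesis
    by (simp add: algebra_simps)
qed

lemma smooth_phi_power: "smooth_on P I \<Longrightarrow> smooth_on (\<lambda>t. \<phi> t ^ n * P t) I"
  by (induction n) (simp_all add: mult.assoc smooth_on_mult[OF open_I smooth_phi])

text \<open>The exponent rises by one because \<open>covd_e1\<close> multiplies by the equi-affine
  speed. \<open>X\<close> is known in this form on all of \<open>I\<close>, as differentiation
  requires.\<close>

lemma covd_e1_TNB:
  assumes t: "t \<in> I"
    and X: "\<And>s. s \<in> I \<Longrightarrow> X s = (\<phi> s ^ n * P s) *\<^sub>t T s +\<^sub>t (\<phi> s ^ n * Q s) *\<^sub>t N s +\<^sub>t (\<phi> s ^ n * R s) *\<^sub>t B s"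
    and S: "smooth_on P I" "smooth_on Q I" "smooth_on R I"
    and D: "(P has_real_derivative P') (at t)" "(Q has_real_derivative Q') (at t)"
      "(R has_real_derivative R') (at t)"
  shows "covd_e1 M D \<alpha> X t =
    (\<phi> t ^ Suc n * (P' + n * \<rho> t * P t - \<epsilon>\<^sub>1 * \<kappa> t * Q t)) *\<^sub>t T t +\<^sub>t
    (\<phi> t ^ Suc n * (\<epsilon>\<^sub>2 * \<kappa> t * P t + Q' + n * \<rho> t * Q t - \<epsilon>\<^sub>2 * \<tau> t * R t)) *\<^sub>t N t +\<^sub>t
    (\<phi> t ^ Suc n * (R' + n * \<rho> t * R t + \<epsilon>\<^sub>3 * \<tau> t * Q t)) *\<^sub>t B t"
proof -
  note S' = S[THEN smooth_phi_power, of n]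
  have eq: "covd M D \<alpha> X t =
      covd M D \<alpha> (\<lambda>s. (\<phi> s ^ n * P s) *\<^sub>t T s +\<^sub>t (\<phi> s ^ n * Q s) *\<^sub>t N s +\<^sub>t (\<phi> s ^ n * R s) *\<^sub>t B s) t"
    by (rule covd_cong[OF field_TNB[OF S'] _ t, symmetric]) (simp add: X)
  show ?thesis
    unfolding covd_e1_def equiaffine_speed_eq[OF t] eq
      covd_TNB[OF t S' D[THEN phi_power_derivative[OF t]]] by (simp add: fun_eq_iff algebra_simps)
qed

lemma tvec_zero_terms: "u +\<^sub>t 0 *\<^sub>t v = u" "0 *\<^sub>t v +\<^sub>t u = u"
  by (simp_all add: fun_eq_iff)

lemma cartan_e1_eq: "t \<in> I \<Longrightarrow> cartan_e1 M D \<alpha> t = \<phi> t *\<^sub>t T t"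
  by (simp add: cartan_e1_def equiaffine_speed_eq)

lemma cartan_e2_eq:
  assumes "t \<in> I"
  shows "cartan_e2 M D \<alpha> t = (\<phi> t ^ 2 * \<rho> t) *\<^sub>t T t +\<^sub>t (\<phi> t ^ 2 * (\<epsilon>\<^sub>2 * \<kappa> t)) *\<^sub>t N t"
  unfolding cartan_e2_def
  \<comment> \<open>The first Cartan vector is the case \<open>n = 1\<close> with constant
    components 1, 0, 0.\<close>
  by (subst covd_e1_TNB[OF assms, of _ 1 "\<lambda>_. 1" "\<lambda>_. 0" "\<lambda>_. 0" 0 0 0])
     (auto simp: cartan_e1_eq tvec_zero_terms numeral_2_eq_2 intro: smooth_on_const)

text \<open>
  \<open>P\<^sub>n\<close>, \<open>Q\<^sub>n\<close>, \<open>R\<^sub>n\<close> are the Frenet components, divided by \<open>\<phi>\<^sup>n\<close>, of the third Cartan vector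
  (\<open>n = 3\<close>) and of its derivative in the direction of the first one (\<open>n = 4\<close>, where \<open>R\<^sub>4 = 0\<close>).
\<close>

definition P3 :: "real \<Rightarrow> real" where
  "P3 t = \<rho>' t + 2 * (\<rho> t)\<^sup>2 - \<epsilon>\<^sub>1 * \<epsilon>\<^sub>2 * (\<kappa> t)\<^sup>2"

definition Q3 :: "real \<Rightarrow> real" where
  "Q3 t = \<epsilon>\<^sub>2 * (3 * \<rho> t * \<kappa> t + \<kappa>' t)"

definition R3 :: "real \<Rightarrow> real" where
  "R3 t = \<epsilon>\<^sub>2 * \<epsilon>\<^sub>3 * (\<kappa> t * \<tau> t)"

lemma cartan_e3_eq:
  assumes "t \<in> I"
  shows "cartan_e3 M D \<alpha> t =
    (\<phi> t ^ 3 * P3 t) *\<^sub>t T t +\<^sub>t (\<phi> t ^ 3 * Q3 t) *\<^sub>t N t +\<^sub>t (\<phi> t ^ 3 * R3 t) *\<^sub>t B t"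
proof -
  have "cartan_e3 M D \<alpha> t =
    (\<phi> t ^ Suc 2 * (\<rho>' t + real 2 * \<rho> t * \<rho> t - \<epsilon>\<^sub>1 * \<kappa> t * (\<epsilon>\<^sub>2 * \<kappa> t))) *\<^sub>t T t +\<^sub>t
    (\<phi> t ^ Suc 2 * (\<epsilon>\<^sub>2 * \<kappa> t * \<rho> t + \<epsilon>\<^sub>2 * \<kappa>' t + real 2 * \<rho> t * (\<epsilon>\<^sub>2 * \<kappa> t) - \<epsilon>\<^sub>2 * \<tau> t * 0)) *\<^sub>t N t +\<^sub>t
    (\<phi> t ^ Suc 2 * (0 + real 2 * \<rho> t * 0 + \<epsilon>\<^sub>3 * \<tau> t * (\<epsilon>\<^sub>2 * \<kappa> t))) *\<^sub>t B t"
    unfolding cartan_e3_def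
    by (rule covd_e1_TNB[OF assms])
       (auto simp: cartan_e2_eq tvec_zero_terms intro!: smooth_on_const smooth_rho smooth_on_mult
          smooth_curvature open_I rho_derivative[OF assms] DERIV_cmult derivatives[OF assms])
  moreover have "Suc 2 = 3" by simp
  ultimately show ?thesis
    by (simp add: P3_def Q3_def R3_def power2_eq_square algebra_simps)
qed

section \<open>The equi-affine curvatures\<close>

definition P4 :: "real \<Rightarrow> real" where
  "P4 t = \<rho>'' t + 4 * \<rho> t * \<rho>' t - 2 * \<epsilon>\<^sub>1 * \<epsilon>\<^sub>2 * \<kappa> t * \<kappa>' t + 3 * \<rho> t * P3 t - \<epsilon>\<^sub>1 * \<kappa> t * Q3 t"

definition Q4 :: "real \<Rightarrow> real" where
  "Q4 t = \<epsilon>\<^sub>2 * \<kappa> t * P3 t + \<epsilon>\<^sub>2 * (3 * \<rho>' t * \<kappa> t + 3 * \<rho> t * \<kappa>' t + \<kappa>'' t) +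
    3 * \<rho> t * Q3 t - \<epsilon>\<^sub>2 * \<tau> t * R3 t"

lemma covd_e1_cartan_e3:
  assumes t: "t \<in> I"
  shows "covd_e1 M D \<alpha> (cartan_e3 M D \<alpha>) t = (\<phi> t ^ 4 * P4 t) *\<^sub>t T t +\<^sub>t (\<phi> t ^ 4 * Q4 t) *\<^sub>t N t"
proof -
  note smooth = smooth_on_add smooth_on_mult smooth_on_const smooth_rho smooth_rho'
    smooth_curvature smooth_torsion smooth_derivatives open_I
  have P: "P3 = (\<lambda>t. \<rho>' t + 2 * (\<rho> t * \<rho> t) + (- \<epsilon>\<^sub>1 * \<epsilon>\<^sub>2) * (\<kappa> t * \<kappa> t))"
    by (simp add: fun_eq_iff P3_def power2_eq_square)
  have S: "smooth_on P3 I" "smooth_on Q3 I" "smooth_on R3 I"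
    unfolding P Q3_def[abs_def] R3_def[abs_def] by (intro smooth)+
  note d = derivatives[OF t] rho_derivative[OF t] rho'_derivative[OF t]
  have dP: "(P3 has_real_derivative \<rho>'' t + 4 * \<rho> t * \<rho>' t - 2 * \<epsilon>\<^sub>1 * \<epsilon>\<^sub>2 * \<kappa> t * \<kappa>' t) (at t)"
    unfolding P3_def[abs_def] by (rule derivative_eq_intros d refl)+ simp
  have dQ: "(Q3 has_real_derivative \<epsilon>\<^sub>2 * (3 * \<rho>' t * \<kappa> t + 3 * \<rho> t * \<kappa>' t + \<kappa>'' t)) (at t)"
    unfolding Q3_def[abs_def] by (rule derivative_eq_intros d refl)+ simp
  have dR: "(R3 has_real_derivative \<epsilon>\<^sub>2 * \<epsilon>\<^sub>3 * (\<kappa>' t * \<tau> t + \<kappa> t * \<tau>' t)) (at t)"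
    unfolding R3_def[abs_def] by (rule derivative_eq_intros d refl)+ simp
  \<comment> \<open>The \<open>B\<close> component vanishes: \<open>Q3\<close> contributes
    \<open>3 * \<rho> * \<kappa> + \<kappa>'\<close>, and six times \<open>\<rho>\<close> cancels
    the logarithmic derivative of \<open>\<kappa>\<^sup>2 \<tau>\<close>.\<close>
  have "\<epsilon>\<^sub>2 * \<epsilon>\<^sub>3 * (\<kappa>' t * \<tau> t + \<kappa> t * \<tau>' t) + real 3 * \<rho> t * R3 t + \<epsilon>\<^sub>3 * \<tau> t * Q3 t = 0"
    using curvature_pos[OF t] torsion_nonzero[OF t]
    by (simp add: R3_def Q3_def \<rho>_def field_simps)
  with covd_e1_TNB[OF t cartan_e3_eq S dP dQ dR] show ?thesis
    by (simp add: P4_def Q4_def tvec_zero_terms)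
qed

text \<open>The system for the two curvatures is triangular: the first Cartan vector has no
  \<open>N\<close> component, so the \<open>N\<close> component gives the second curvature and the
  \<open>T\<close> component then the first.\<close>

lemma
  assumes t: "t \<in> I"
  shows equiaffine_curvature1_eq: "equiaffine_curvature1 M D \<alpha> t = \<phi> t ^ 3 * (P4 t - \<epsilon>\<^sub>2 * Q4 t * \<rho> t / \<kappa> t)"
    and equiaffine_curvature2_eq: "equiaffine_curvature2 M D \<alpha> t = \<phi> t ^ 2 * (\<epsilon>\<^sub>2 * Q4 t / \<kappa> t)"
proof -
  let ?k1 = "\<phi> t ^ 3 * (P4 t - \<epsilon>\<^sub>2 * Q4 t * \<rho> t / \<kappa> t)" and ?k2 = "\<phi> t ^ 2 * (\<epsilon>\<^sub>2 * Q4 t / \<kappa> t)"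
  have nz: "\<phi> t > 0" "\<kappa> t > 0" by (intro phi_pos curvature_pos t)+
  have e: "a *\<^sub>t cartan_e1 M D \<alpha> t +\<^sub>t b *\<^sub>t cartan_e2 M D \<alpha> t =
      (a * \<phi> t + b * \<phi> t ^ 2 * \<rho> t) *\<^sub>t T t +\<^sub>t (b * \<phi> t ^ 2 * \<epsilon>\<^sub>2 * \<kappa> t) *\<^sub>t N t" for a b
    by (simp add: cartan_e1_eq cartan_e2_eq t fun_eq_iff algebra_simps)
  \<comment> \<open>Independence of \<open>T\<close> and \<open>N\<close>, obtained by pairing both
    sides with each of them.\<close>
  have TN: "p = p' \<and> q = q'" if "p *\<^sub>t T t +\<^sub>t q *\<^sub>t N t = p' *\<^sub>t T t +\<^sub>t q' *\<^sub>t N t" for p q p' q'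
    using metric_TNB(1,2)[OF t, of p q 0] metric_TNB(1,2)[OF t, of p' q' 0] that eps1 eps2
    by (auto simp: tvec_zero_terms)
  have "equiaffine_curvatures M D \<alpha> t = (?k1, ?k2)"
    unfolding equiaffine_curvatures_def covd_e1_cartan_e3[OF t] e
  proof (rule the_equality)
    have "\<phi> t ^ 4 * P4 t = ?k1 * \<phi> t + ?k2 * \<phi> t ^ 2 * \<rho> t"
      by (simp add: algebra_simps power_numeral_reduce add_divide_distrib)
    moreover have "\<phi> t ^ 4 * Q4 t = ?k2 * \<phi> t ^ 2 * \<epsilon>\<^sub>2 * \<kappa> t"
      using nz eps2 by (auto simp: power_numeral_reduce)
    ultimately show "(\<phi> t ^ 4 * P4 t) *\<^sub>t T t +\<^sub>t (\<phi> t ^ 4 * Q4 t) *\<^sub>t N t =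
        (fst (?k1, ?k2) * \<phi> t + snd (?k1, ?k2) * \<phi> t ^ 2 * \<rho> t) *\<^sub>t T t +\<^sub>t
        (snd (?k1, ?k2) * \<phi> t ^ 2 * \<epsilon>\<^sub>2 * \<kappa> t) *\<^sub>t N t"
      by simp
  next
    fix k assume "(\<phi> t ^ 4 * P4 t) *\<^sub>t T t +\<^sub>t (\<phi> t ^ 4 * Q4 t) *\<^sub>t N t =
        (fst k * \<phi> t + snd k * \<phi> t ^ 2 * \<rho> t) *\<^sub>t T t +\<^sub>t (snd k * \<phi> t ^ 2 * \<epsilon>\<^sub>2 * \<kappa> t) *\<^sub>t N t"
    note eq = TN[OF this]
    have "\<epsilon>\<^sub>2 * (\<phi> t ^ 4 * Q4 t) = snd k * \<phi> t ^ 2 * \<kappa> t * (\<epsilon>\<^sub>2 * \<epsilon>\<^sub>2)"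
      using eq by simp
    then have 2: "snd k = ?k2"
      using nz by (simp add: eps_square field_simps power_numeral_reduce)
    have "fst k * \<phi> t = \<phi> t ^ 4 * P4 t - snd k * \<phi> t ^ 2 * \<rho> t"
      using eq by simp
    also have "\<dots> = ?k1 * \<phi> t"
      unfolding 2 by (simp add: algebra_simps power_numeral_reduce)
    finally have "fst k = ?k1"
      using nz by simp
    with 2 show "k = (?k1, ?k2)" by (simp add: prod_eq_iff)
  qed
  then show "equiaffine_curvature1 M D \<alpha> t = ?k1" "equiaffine_curvature2 M D \<alpha> t = ?k2"
    by (simp_all add: equiaffine_curvature1_def equiaffine_curvature2_def)
qed

section \<open>Coefficients in terms of curvature and torsion\<close>

lemma cartan_coefficients:
  assumes t: "t \<in> I"
  shows "\<rho> t = - (1/6) * (2 * \<tau> t * \<kappa>' t + \<kappa> t * \<tau>' t) / (\<kappa> t * \<tau> t)"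
    and "P3 t = 1/18 * (- 18 * \<epsilon>\<^sub>1 * \<epsilon>\<^sub>2 * \<kappa> t ^ 4 * \<tau> t ^ 2
           + 10 * \<tau> t ^ 2 * \<kappa>' t ^ 2
           + 4 * \<kappa> t * \<tau> t * \<kappa>' t * \<tau>' t
           + 4 * \<kappa> t ^ 2 * \<tau>' t ^ 2
           - 6 * \<kappa> t * \<tau> t ^ 2 * \<kappa>'' t
           - 3 * \<kappa> t ^ 2 * \<tau> t * \<tau>'' t) / (\<kappa> t ^ 2 * \<tau> t ^ 2)"
    and "Q3 t = - (1/2) * \<epsilon>\<^sub>2 * \<kappa> t * \<tau>' t / \<tau> t"
    and "P4 t - \<epsilon>\<^sub>2 * Q4 t * \<rho> t / \<kappa> t =
        1/216 * (- 288 * \<epsilon>\<^sub>1 * \<epsilon>\<^sub>2 * \<kappa> t ^ 4 * \<tau> t ^ 3 * \<kappa>' t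
           - 72 * \<epsilon>\<^sub>2 * \<epsilon>\<^sub>3 * \<kappa> t ^ 2 * \<tau> t ^ 5 * \<kappa>' t
           - 320 * \<tau> t ^ 3 * \<kappa>' t ^ 3
           + 180 * \<epsilon>\<^sub>1 * \<epsilon>\<^sub>2 * \<kappa> t ^ 5 * \<tau> t ^ 2 * \<tau>' t
           - 36 * \<epsilon>\<^sub>2 * \<epsilon>\<^sub>3 * \<kappa> t ^ 3 * \<tau> t ^ 4 * \<tau>' t
           - 120 * \<kappa> t * \<tau> t ^ 2 * \<kappa>' t ^ 2 * \<tau>' t
           - 42 * \<kappa> t ^ 2 * \<tau> t * \<kappa>' t * \<tau>' t ^ 2
           - 85 * \<kappa> t ^ 3 * \<tau>' t ^ 3
           + 360 * \<kappa> t * \<tau> t ^ 3 * \<kappa>' t * \<kappa>'' t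
           + 72 * \<kappa> t ^ 2 * \<tau> t ^ 2 * \<tau>' t * \<kappa>'' t
           + 36 * \<kappa> t ^ 2 * \<tau> t ^ 2 * \<kappa>' t * \<tau>'' t
           + 126 * \<kappa> t ^ 3 * \<tau> t * \<tau>' t * \<tau>'' t
           - 72 * \<kappa> t ^ 2 * \<tau> t ^ 3 * \<kappa>''' t
           - 36 * \<kappa> t ^ 3 * \<tau> t ^ 2 * \<tau>''' t) / (\<kappa> t ^ 3 * \<tau> t ^ 3)"
    and "\<epsilon>\<^sub>2 * Q4 t / \<kappa> t =
        1/36 * (- 36 * \<epsilon>\<^sub>1 * \<epsilon>\<^sub>2 * \<kappa> t ^ 4 * \<tau> t ^ 2
           - 36 * \<epsilon>\<^sub>2 * \<epsilon>\<^sub>3 * \<kappa> t ^ 2 * \<tau> t ^ 4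
           + 20 * \<tau> t ^ 2 * \<kappa>' t ^ 2
           + 8 * \<kappa> t * \<tau> t * \<kappa>' t * \<tau>' t
           + 35 * \<kappa> t ^ 2 * \<tau>' t ^ 2
           - 12 * \<kappa> t * \<tau> t ^ 2 * \<kappa>'' t
           - 24 * \<kappa> t ^ 2 * \<tau> t * \<tau>'' t) / (\<kappa> t ^ 2 * \<tau> t ^ 2)"
proof -
  have nz: "\<kappa> t \<noteq> 0" "\<tau> t \<noteq> 0"
    using curvature_pos[OF t] torsion_nonzero[OF t] by auto
  \<comment> \<open>Dividing each derivative by \<open>\<kappa>\<close> or \<open>\<tau>\<close>
    makes \<open>\<rho>\<close> and its derivatives polynomial in these ratios, so the identities
    become polynomial after clearing powers of \<open>\<kappa>\<close> and
    \<open>\<tau>\<close>.\<close>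
  define l l2 l3 where "l = \<kappa>' t / \<kappa> t" and "l2 = \<kappa>'' t / \<kappa> t" and "l3 = \<kappa>''' t / \<kappa> t"
  define m m2 m3 where "m = \<tau>' t / \<tau> t" and "m2 = \<tau>'' t / \<tau> t" and "m3 = \<tau>''' t / \<tau> t"
  have s: "\<kappa>' t = \<kappa> t * l" "\<kappa>'' t = \<kappa> t * l2" "\<kappa>''' t = \<kappa> t * l3"
    "\<tau>' t = \<tau> t * m" "\<tau>'' t = \<tau> t * m2" "\<tau>''' t = \<tau> t * m3"
    using nz by (simp_all add: l_def l2_def l3_def m_def m2_def m3_def)
  have r: "\<rho> t = - l / 3 - m / 6" "\<rho>' t = - (l2 - l\<^sup>2) / 3 - (m2 - m\<^sup>2) / 6"
    "\<rho>'' t = - (l3 - 3 * l * l2 + 2 * l ^ 3) / 3 - (m3 - 3 * m * m2 + 2 * m ^ 3) / 6"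
    using nz by (simp_all add: \<rho>_def \<rho>'_def \<rho>''_def s power2_eq_square mult.assoc)
  have e: "\<epsilon>\<^sub>2 * (\<epsilon>\<^sub>2 * x) = x" for x
    using eps_square(2) by (simp flip: mult.assoc)
  have Q3: "Q3 t = - (1/2) * \<epsilon>\<^sub>2 * \<kappa> t * m"
    by (simp add: Q3_def r s algebra_simps)
  have Q4: "\<epsilon>\<^sub>2 * Q4 t / \<kappa> t = P3 t + 3 * \<rho>' t + 3 * \<rho> t * l + l2 - 3/2 * \<rho> t * m - \<epsilon>\<^sub>2 * \<epsilon>\<^sub>3 * (\<tau> t)\<^sup>2"
    using nz by (simp add: Q4_def Q3 R3_def s e field_simps power2_eq_square)
  show "\<rho> t = - (1/6) * (2 * \<tau> t * \<kappa>' t + \<kappa> t * \<tau>' t) / (\<kappa> t * \<tau> t)"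
    unfolding r s using nz by (simp add: field_simps)
  show "Q3 t = - (1/2) * \<epsilon>\<^sub>2 * \<kappa> t * \<tau>' t / \<tau> t"
    using nz by (simp add: Q3 s)
  show "P3 t = 1/18 * (- 18 * \<epsilon>\<^sub>1 * \<epsilon>\<^sub>2 * \<kappa> t ^ 4 * \<tau> t ^ 2
           + 10 * \<tau> t ^ 2 * \<kappa>' t ^ 2
           + 4 * \<kappa> t * \<tau> t * \<kappa>' t * \<tau>' t
           + 4 * \<kappa> t ^ 2 * \<tau>' t ^ 2
           - 6 * \<kappa> t * \<tau> t ^ 2 * \<kappa>'' t
           - 3 * \<kappa> t ^ 2 * \<tau> t * \<tau>'' t) / (\<kappa> t ^ 2 * \<tau> t ^ 2)"
    unfolding P3_def r s using nz by (simp add: field_simps power_numeral_reduce)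
  show "\<epsilon>\<^sub>2 * Q4 t / \<kappa> t =
        1/36 * (- 36 * \<epsilon>\<^sub>1 * \<epsilon>\<^sub>2 * \<kappa> t ^ 4 * \<tau> t ^ 2
           - 36 * \<epsilon>\<^sub>2 * \<epsilon>\<^sub>3 * \<kappa> t ^ 2 * \<tau> t ^ 4
           + 20 * \<tau> t ^ 2 * \<kappa>' t ^ 2
           + 8 * \<kappa> t * \<tau> t * \<kappa>' t * \<tau>' t
           + 35 * \<kappa> t ^ 2 * \<tau>' t ^ 2
           - 12 * \<kappa> t * \<tau> t ^ 2 * \<kappa>'' t
           - 24 * \<kappa> t ^ 2 * \<tau> t * \<tau>'' t) / (\<kappa> t ^ 2 * \<tau> t ^ 2)"
    unfolding Q4 P3_def r s using nz by (simp add: field_simps power_numeral_reduce)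
  have "P4 t - \<epsilon>\<^sub>2 * Q4 t * \<rho> t / \<kappa> t = P4 t - (\<epsilon>\<^sub>2 * Q4 t / \<kappa> t) * \<rho> t"
    by simp
  also have "\<dots> = 1/216 * (- 288 * \<epsilon>\<^sub>1 * \<epsilon>\<^sub>2 * \<kappa> t ^ 4 * \<tau> t ^ 3 * \<kappa>' t
           - 72 * \<epsilon>\<^sub>2 * \<epsilon>\<^sub>3 * \<kappa> t ^ 2 * \<tau> t ^ 5 * \<kappa>' t
           - 320 * \<tau> t ^ 3 * \<kappa>' t ^ 3
           + 180 * \<epsilon>\<^sub>1 * \<epsilon>\<^sub>2 * \<kappa> t ^ 5 * \<tau> t ^ 2 * \<tau>' t
           - 36 * \<epsilon>\<^sub>2 * \<epsilon>\<^sub>3 * \<kappa> t ^ 3 * \<tau> t ^ 4 * \<tau>' t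
           - 120 * \<kappa> t * \<tau> t ^ 2 * \<kappa>' t ^ 2 * \<tau>' t
           - 42 * \<kappa> t ^ 2 * \<tau> t * \<kappa>' t * \<tau>' t ^ 2
           - 85 * \<kappa> t ^ 3 * \<tau>' t ^ 3
           + 360 * \<kappa> t * \<tau> t ^ 3 * \<kappa>' t * \<kappa>'' t
           + 72 * \<kappa> t ^ 2 * \<tau> t ^ 2 * \<tau>' t * \<kappa>'' t
           + 36 * \<kappa> t ^ 2 * \<tau> t ^ 2 * \<kappa>' t * \<tau>'' t
           + 126 * \<kappa> t ^ 3 * \<tau> t * \<tau>' t * \<tau>'' t
           - 72 * \<kappa> t ^ 2 * \<tau> t ^ 3 * \<kappa>''' t
           - 36 * \<kappa> t ^ 3 * \<tau> t ^ 2 * \<tau>''' t) / (\<kappa> t ^ 3 * \<tau> t ^ 3)"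
    unfolding Q4 P4_def Q3 P3_def r s using nz by (simp add: field_simps power_numeral_reduce)
  finally show "P4 t - \<epsilon>\<^sub>2 * Q4 t * \<rho> t / \<kappa> t = \<dots>" .
qed

end

text \<open>All fractional powers of the curvature are reduced to the exponent -2/3 occurring in the
  square of \<open>\<phi>\<close>, so that only a rational identity is left.\<close>

lemma powr_thirds:
  fixes x :: real
  assumes "x > 0"
  shows "x powr (-5/3) = x powr (-2/3) / x" "x powr (1/3) = x powr (-2/3) * x"
    "x powr (-8/3) = x powr (-2/3) / x ^ 2"
proof -
  have "x powr (-2/3 - 1) = x powr (-2/3) / x" "x powr (-2/3 + 1) = x powr (-2/3) * x"
    "x powr (-2/3 - 2) = x powr (-2/3) / x ^ 2"
    using assms by (simp_all only: powr_diff powr_add powr_one less_imp_le powr_numeral)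
  then show "x powr (-5/3) = x powr (-2/3) / x" "x powr (1/3) = x powr (-2/3) * x"
    "x powr (-8/3) = x powr (-2/3) / x ^ 2"
    by simp_all
qed

lemma powi_negative:
  fixes x :: real
  shows "x powi (-2) = inverse (x ^ 2)" "x powi (-3) = inverse (x ^ 3)" "x powi (-4) = inverse (x ^ 4)"
  by (simp_all add: power_int_minus)

theorem theorem2:
  fixes M :: "'a psr3" and D :: "'a connection" and I :: "real set" and \<alpha> :: "real \<Rightarrow> 'a"
    and T N B e\<^sub>1 e\<^sub>2 e\<^sub>3 :: "real \<Rightarrow> 'a tvec"
    and \<kappa> \<kappa>' \<kappa>'' \<kappa>''' \<tau> \<tau>' \<tau>'' \<tau>''' k\<^sub>1 k\<^sub>2 :: "real \<Rightarrow> real"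
    and \<epsilon>\<^sub>1 \<epsilon>\<^sub>2 \<epsilon>\<^sub>3 :: real
  assumes M: "connected_oriented_psr3 M"
    and D: "levi_civita M D"
    and I: "open I" "is_interval I" "I \<noteq> {}"
    and \<alpha>: "smooth_curve M I \<alpha>" "arc_length_parametrized M I \<alpha>" "nondegenerate_curve M D I \<alpha>"
    and non_null: "\<And>t. t \<in> I \<Longrightarrow>
      metric M (\<alpha> t) (acceleration M D \<alpha> t) (acceleration M D \<alpha> t) \<noteq> 0"
    and frenet: "T = velocity M \<alpha>" "N = principal_normal M D I \<alpha>" "B = binormal M D I \<alpha>"
    and signs: "\<epsilon>\<^sub>1 = frenet_eps1 M I \<alpha>" "\<epsilon>\<^sub>2 = frenet_eps2 M D I \<alpha>" "\<epsilon>\<^sub>3 = frenet_eps3 M D I \<alpha>"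
    and \<kappa>: "\<kappa> = curvature M D I \<alpha>" "\<kappa>' = deriv \<kappa>" "\<kappa>'' = deriv \<kappa>'" "\<kappa>''' = deriv \<kappa>''"
    and \<tau>: "\<tau> = torsion M D I \<alpha>" "\<tau>' = deriv \<tau>" "\<tau>'' = deriv \<tau>'" "\<tau>''' = deriv \<tau>''"
    and cartan: "e\<^sub>1 = cartan_e1 M D \<alpha>" "e\<^sub>2 = cartan_e2 M D \<alpha>" "e\<^sub>3 = cartan_e3 M D \<alpha>"
    and equiaffine: "k\<^sub>1 = equiaffine_curvature1 M D \<alpha>" "k\<^sub>2 = equiaffine_curvature2 M D \<alpha>"
  shows "\<forall>t\<in>I.
    e\<^sub>1 t = (\<kappa> t powr (-1/3) * \<bar>\<tau> t\<bar> powr (-1/6)) *\<^sub>t T t \<and>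
    e\<^sub>2 t =
      (- (1/6) * \<kappa> t powr (-5/3) * inverse (\<tau> t) * \<bar>\<tau> t\<bar> powr (-1/3)
        * (2 * \<tau> t * \<kappa>' t + \<kappa> t * \<tau>' t)) *\<^sub>t T t
      +\<^sub>t (\<epsilon>\<^sub>2 * \<kappa> t powr (1/3) * \<bar>\<tau> t\<bar> powr (-1/3)) *\<^sub>t N t \<and>
    e\<^sub>3 t =
      (1/18 * \<kappa> t powi (-3) * \<tau> t powi (-2) * \<bar>\<tau> t\<bar> powr (-1/2)
        * (- 18 * \<epsilon>\<^sub>1 * \<epsilon>\<^sub>2 * \<kappa> t ^ 4 * \<tau> t ^ 2
           + 10 * \<tau> t ^ 2 * \<kappa>' t ^ 2
           + 4 * \<kappa> t * \<tau> t * \<kappa>' t * \<tau>' t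
           + 4 * \<kappa> t ^ 2 * \<tau>' t ^ 2
           - 6 * \<kappa> t * \<tau> t ^ 2 * \<kappa>'' t
           - 3 * \<kappa> t ^ 2 * \<tau> t * \<tau>'' t)) *\<^sub>t T t
      +\<^sub>t (- (1/2) * \<epsilon>\<^sub>2 * inverse (\<tau> t) * \<bar>\<tau> t\<bar> powr (-1/2) * \<tau>' t) *\<^sub>t N t
      +\<^sub>t (\<epsilon>\<^sub>2 * \<epsilon>\<^sub>3 * \<tau> t * \<bar>\<tau> t\<bar> powr (-1/2)) *\<^sub>t B t \<and>
    k\<^sub>1 t =
      1/216 * \<kappa> t powi (-4) * \<tau> t powi (-3) * \<bar>\<tau> t\<bar> powr (-1/2)
        * (- 288 * \<epsilon>\<^sub>1 * \<epsilon>\<^sub>2 * \<kappa> t ^ 4 * \<tau> t ^ 3 * \<kappa>' t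
           - 72 * \<epsilon>\<^sub>2 * \<epsilon>\<^sub>3 * \<kappa> t ^ 2 * \<tau> t ^ 5 * \<kappa>' t
           - 320 * \<tau> t ^ 3 * \<kappa>' t ^ 3
           + 180 * \<epsilon>\<^sub>1 * \<epsilon>\<^sub>2 * \<kappa> t ^ 5 * \<tau> t ^ 2 * \<tau>' t
           - 36 * \<epsilon>\<^sub>2 * \<epsilon>\<^sub>3 * \<kappa> t ^ 3 * \<tau> t ^ 4 * \<tau>' t
           - 120 * \<kappa> t * \<tau> t ^ 2 * \<kappa>' t ^ 2 * \<tau>' t
           - 42 * \<kappa> t ^ 2 * \<tau> t * \<kappa>' t * \<tau>' t ^ 2
           - 85 * \<kappa> t ^ 3 * \<tau>' t ^ 3
           + 360 * \<kappa> t * \<tau> t ^ 3 * \<kappa>' t * \<kappa>'' t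
           + 72 * \<kappa> t ^ 2 * \<tau> t ^ 2 * \<tau>' t * \<kappa>'' t
           + 36 * \<kappa> t ^ 2 * \<tau> t ^ 2 * \<kappa>' t * \<tau>'' t
           + 126 * \<kappa> t ^ 3 * \<tau> t * \<tau>' t * \<tau>'' t
           - 72 * \<kappa> t ^ 2 * \<tau> t ^ 3 * \<kappa>''' t
           - 36 * \<kappa> t ^ 3 * \<tau> t ^ 2 * \<tau>''' t) \<and>
    k\<^sub>2 t =
      1/36 * \<kappa> t powr (-8/3) * \<tau> t powi (-2) * \<bar>\<tau> t\<bar> powr (-1/3)
        * (- 36 * \<epsilon>\<^sub>1 * \<epsilon>\<^sub>2 * \<kappa> t ^ 4 * \<tau> t ^ 2
           - 36 * \<epsilon>\<^sub>2 * \<epsilon>\<^sub>3 * \<kappa> t ^ 2 * \<tau> t ^ 4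
           + 20 * \<tau> t ^ 2 * \<kappa>' t ^ 2
           + 8 * \<kappa> t * \<tau> t * \<kappa>' t * \<tau>' t
           + 35 * \<kappa> t ^ 2 * \<tau>' t ^ 2
           - 12 * \<kappa> t * \<tau> t ^ 2 * \<kappa>'' t
           - 24 * \<kappa> t ^ 2 * \<tau> t * \<tau>'' t)"
proof -
  interpret frenet_curve M D I \<alpha>
    by unfold_locales
       (use M D I \<alpha> non_null in \<open>auto simp: connected_oriented_psr3_def\<close>)
  note defs = frenet signs \<kappa> \<tau> cartan equiaffine
  note nz = curvature_pos[THEN less_imp_neq, symmetric] torsion_nonzero
  show ?thesis
  proof (intro ballI conjI, goal_cases)
    case (1 t)
    show ?case
      unfolding defs cartan_e1_eq[OF 1] \<phi>_def by (rule refl)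
  next
    case (2 t)
    show ?case
      unfolding defs powr_thirds[OF curvature_pos[OF 2]] cartan_e2_eq[OF 2] phi_powers[OF 2]
        cartan_coefficients(1)[OF 2]
      \<comment> \<open>Both sides use the same frame vectors, so the vector equation splits into
        one scalar equation per coefficient.\<close>
      by (intro arg_cong2[of _ _ _ _ "(+\<^sub>t)"] arg_cong2[of _ _ _ _ "(*\<^sub>t)"] refl)
         (use nz[OF 2] in \<open>simp_all add: field_simps\<close>)
  next
    case (3 t)
    show ?case
      unfolding defs powi_negative cartan_e3_eq[OF 3] phi_powers[OF 3] cartan_coefficients(2,3)[OF 3] R3_def
      by (intro arg_cong2[of _ _ _ _ "(+\<^sub>t)"] arg_cong2[of _ _ _ _ "(*\<^sub>t)"] refl)
         (use nz[OF 3] in \<open>simp_all add: divide_simps, simp_all add: power_numeral_reduce\<close>)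
  next
    case (4 t)
    show ?case
      unfolding defs powi_negative equiaffine_curvature1_eq[OF 4] phi_powers[OF 4] cartan_coefficients(4)[OF 4]
      using nz[OF 4] by (simp add: divide_simps power_numeral_reduce)
  next
    case (5 t)
    show ?case
      unfolding defs powi_negative powr_thirds[OF curvature_pos[OF 5]] equiaffine_curvature2_eq[OF 5]
        phi_powers[OF 5] cartan_coefficients(5)[OF 5]
      using nz[OF 5] by (simp add: divide_simps power_numeral_reduce)
  qed
qed

end
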